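(* Let $\rho_f=\tilde\rho_f$ be one of the eigenstates (rank-one eigenprojectors) of the measurement operator $L=J_z$. Fix $t\ge 0$, $\Delta t>0$, and a current density matrix $\rho(t)$. Consider the infinite-horizon SMPC problem $$\min_{u(s),\ s\in[t,t+\Delta t]}\ J(u),\qquad J(u)=\lim_{T\to\infty}\frac1T\int_\Omega\int_t^T d_B^2\bigl(\rho(s,\omega,u),\rho_f\bigr)\,ds\,d\mu(\omega),$$ subject to: $\rho(s)|_{s=t}=\rho(t)$; $\rho(s)=\rho(s,\omega,u)$ evolves under the stochastic master equation given in the context; $u(s)\in\mathcal U$ for all $s\in[t,t+\Delta t]$. This problem is equivalent to the optimization problem $$\min_{u(s),\ s\in[t,t+\Delta t]}\ 2\Bigl(1-\operatorname{Tr}\bigl[\rho(t+\Delta t;u)\,\rho_f\bigr]\Bigr),$$ subject to the same dynamics and the same admissibility constraint $u(s)\in\mathcal U$, where $\rho(t+\Delta t;u):=\mathbb E_\omega[\rho(t+\Delta t,\omega,u)]$ is the state averaged over the measurement noise. Here "equivalent" means that the two objective functions coincide: for every admissible $u$, the limit defining $J(u)$ exists and $J(u)=2\bigl(1-\operatorname{Tr}[\rho(t+\Delta t;u)\rho_f]\bigr)$.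
   Context: The system is an $N$-level angular momentum system ($N=2j+1$, $j\in\{\tfrac12,1,\tfrac32,\dots\}$) with $H_0=L=J_z$, where $J_z=\operatorname{diag}(j,j-1,\dots,-j)$ is the $z$-component of angular momentum. Write $J_z|\phi_k\rangle=\lambda_k|\phi_k\rangle$ with $\{|\phi_k\rangle\}_{k=1}^N$ orthonormal; the eigenstates are $\tilde\rho_k=|\phi_k\rangle\langle\phi_k|$, and $\sum_k\tilde\rho_k=I$. The state $\rho_s$ is an $N\times N$ density matrix (positive semidefinite, trace one) evolving by the Itô stochastic master equation $$d\rho_s=-i[H_0+H_u(s),\rho_s]\,ds+L\rho_sL^\dagger ds-\tfrac12\{L^\dagger L,\rho_s\}ds+\sqrt\eta\,\bigl(L\rho_s+\rho_sL^\dagger-\operatorname{Tr}[(L+L^\dagger)\rho_s]\rho_s\bigr)dW_s,$$ where $W$ is a standard one-dimensional Wiener process on a probability space $(\Omega,\mu)$, $\eta\in(0,1]$ is the measurement efficiency, $[A,B]=AB-BA$, $\{A,B\}=AB+BA$, and $H_u(s)=u(s)H_c$ with $H_c$ a fixed Hermitian matrix. $\rho(s,\omega,u)$ denotes the solution for noise realization $\omega\in\Omega$ and control $u$, started from $\rho(t)$ at time $t$. Admissible controls are deterministic (open-loop) bounded measurable functions $u:[t,t+\Delta t]\to\mathbb R$ with values in a given set $\mathcal U$. After time $t+\Delta t$ the control is switched off: $u(s)=0$ for $s>t+\Delta t$. The Bures distance is $d_B(\rho_a,\rho_b)=\sqrt{2-2\operatorname{Tr}\bigl(\sqrt{\sqrt{\rho_b}\,\rho_a\sqrt{\rho_b}}\bigr)}$.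 *)

theory Defs
  imports "HOL-Probability.Probability"
begin

section \<open>Complex matrices and quantum states\<close>

type_synonym 'n cvec = "complex ^ 'n"
type_synonym 'n cmat = "complex ^ 'n ^ 'n"

definition cscale :: "complex \<Rightarrow> 'n::finite cmat \<Rightarrow> 'n cmat" where
  "cscale c A = (\<chi> i j. c * A $ i $ j)"

definition dagger :: "'n::finite cmat \<Rightarrow> 'n cmat" where
  "dagger A = (\<chi> i j. cnj (A $ j $ i))"

definition commutator :: "'n::finite cmat \<Rightarrow> 'n cmat \<Rightarrow> 'n cmat" where
  "commutator A B = A ** B - B ** A"

definition anticommutator :: "'n::finite cmat \<Rightarrow> 'n cmat \<Rightarrow> 'n cmat" where
  "anticommutator A B = A ** B + B ** A"

text \<open>The library's inner product on \<open>complex ^ 'n\<close> is real-valued; this is the Hermitian one,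
  conjugate-linear in the first argument.\<close>

definition braket :: "'n::finite cvec \<Rightarrow> 'n cvec \<Rightarrow> complex" where
  "braket v w = (\<Sum>i\<in>UNIV. cnj (v $ i) * w $ i)"

definition ketbra :: "'n::finite cvec \<Rightarrow> 'n cvec \<Rightarrow> 'n cmat" where
  "ketbra v w = (\<chi> i j. v $ i * cnj (w $ j))"

definition hermitian :: "'n::finite cmat \<Rightarrow> bool" where
  "hermitian A \<longleftrightarrow> dagger A = A"

definition psd :: "'n::finite cmat \<Rightarrow> bool" where
  "psd A \<longleftrightarrow> hermitian A \<and> (\<forall>v. 0 \<le> Re (braket v (A *v v)))"

definition density_matrix :: "'n::finite cmat \<Rightarrow> bool" where
  "density_matrix A \<longleftrightarrow> psd A \<and> trace A = 1"

text \<open>Meaningful for positive semidefinite arguments only: the unique positive semidefinite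
  square root.\<close>

definition msqrt :: "'n::finite cmat \<Rightarrow> 'n cmat" where
  "msqrt A = (THE B. psd B \<and> B ** B = A)"

definition bures_dist :: "'n::finite cmat \<Rightarrow> 'n cmat \<Rightarrow> real" where
  "bures_dist A B = sqrt (2 - 2 * Re (trace (msqrt (msqrt B ** A ** msqrt B))))"

text \<open>The standard basis is indexed by a finite linearly ordered type with \<open>2 * j + 1\<close> elements;
  \<open>card {..<k}\<close> is the number of basis vectors preceding \<open>k\<close>, so the diagonal reads
  \<open>j, j - 1, \<dots>, -j\<close>.\<close>

definition J\<^sub>z :: "real \<Rightarrow> 'n::{finite, linorder} cmat" where
  "J\<^sub>z j = (\<chi> k l. if k = l then complex_of_real (j - real (card {..<k})) else 0)"


section \<open>Wiener process and Ito integral\<close>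

text \<open>The time parameter is real, and \<open>F\<close> is a filtration along the whole line, as the library
  locale requires; a filtration given on \<open>[0, \<infinity>)\<close> is extended by \<open>F s = F 0\<close> for negative \<open>s\<close>.\<close>

definition wiener_process ::
    "'w measure \<Rightarrow> (real \<Rightarrow> 'w measure) \<Rightarrow> (real \<Rightarrow> 'w \<Rightarrow> real) \<Rightarrow> bool" where
  "wiener_process M F W \<longleftrightarrow>
     prob_space M \<and> filtration (space M) F \<and> (\<forall>s. subalgebra M (F s)) \<and>
     (\<forall>s\<ge>0. W s \<in> borel_measurable (F s)) \<and>
     (AE \<omega> in M. W 0 \<omega> = 0) \<and>
     (AE \<omega> in M. continuous_on {0..} (\<lambda>s. W s \<omega>)) \<and>
     (\<forall>r s. 0 \<le> r \<and> r < s \<longrightarrow>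
        distributed M lborel (\<lambda>\<omega>. W s \<omega> - W r \<omega>) (normal_density 0 (sqrt (s - r))) \<and>
        prob_space.indep_set M (sets (F r))
          (sets (vimage_algebra (space M) (\<lambda>\<omega>. W s \<omega> - W r \<omega>) borel)))"

text \<open>Simple integrands on \<open>[a, b]\<close>: the value is \<open>\<xi> i\<close> on \<open>(\<tau> i, \<tau> (i + 1)]\<close> for \<open>i < n\<close>.\<close>

definition simple_integrand ::
    "(real \<Rightarrow> 'w measure) \<Rightarrow> real \<Rightarrow> real \<Rightarrow> nat \<Rightarrow> (nat \<Rightarrow> real) \<Rightarrow>
     (nat \<Rightarrow> 'w \<Rightarrow> 'a::euclidean_space) \<Rightarrow> bool" where
  "simple_integrand F a b n \<tau> \<xi> \<longleftrightarrow>
     \<tau> 0 = a \<and> \<tau> n = b \<and> (\<forall>i<n. \<tau> i \<le> \<tau> (Suc i)) \<and>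
     (\<forall>i<n. \<xi> i \<in> borel_measurable (F (\<tau> i)) \<and> bounded (\<xi> i ` space (F (\<tau> i))))"

definition step_fun ::
    "nat \<Rightarrow> (nat \<Rightarrow> real) \<Rightarrow> (nat \<Rightarrow> 'w \<Rightarrow> 'a::euclidean_space) \<Rightarrow> real \<Rightarrow> 'w \<Rightarrow> 'a" where
  "step_fun n \<tau> \<xi> s \<omega> = (\<Sum>i<n. indicator {\<tau> i <.. \<tau> (Suc i)} s *\<^sub>R \<xi> i \<omega>)"

definition elementary_integral ::
    "(real \<Rightarrow> 'w \<Rightarrow> real) \<Rightarrow> nat \<Rightarrow> (nat \<Rightarrow> real) \<Rightarrow>
     (nat \<Rightarrow> 'w \<Rightarrow> 'a::euclidean_space) \<Rightarrow> 'w \<Rightarrow> 'a" where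
  "elementary_integral W n \<tau> \<xi> \<omega> = (\<Sum>i<n. (W (\<tau> (Suc i)) \<omega> - W (\<tau> i) \<omega>) *\<^sub>R \<xi> i \<omega>)"

text \<open>\<open>I\<close> is a version of the Ito integral of \<open>X\<close> against \<open>W\<close> over \<open>[a, b]\<close>, for a measurable,
  adapted and square-integrable \<open>X\<close>: it is the mean-square limit of the elementary integrals of
  simple integrands approximating \<open>X\<close> in mean square. It is determined up to null sets.\<close>

definition has_ito_integral ::
    "'w measure \<Rightarrow> (real \<Rightarrow> 'w measure) \<Rightarrow> (real \<Rightarrow> 'w \<Rightarrow> real) \<Rightarrow> real \<Rightarrow> real \<Rightarrow>
     (real \<Rightarrow> 'w \<Rightarrow> 'a::euclidean_space) \<Rightarrow> ('w \<Rightarrow> 'a) \<Rightarrow> bool" where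
  "has_ito_integral M F W a b X I \<longleftrightarrow>
     (\<lambda>(s, \<omega>). X s \<omega>) \<in> borel_measurable (restrict_space borel {a..b} \<Otimes>\<^sub>M M) \<and>
     (\<forall>s\<in>{a..b}. X s \<in> borel_measurable (F s)) \<and>
     (\<integral>\<^sup>+ \<omega>. (\<integral>\<^sup>+ s\<in>{a..b}. ennreal ((norm (X s \<omega>))\<^sup>2) \<partial>lborel) \<partial>M) < \<infinity> \<and>
     I \<in> borel_measurable M \<and>
     (\<exists>n \<tau> \<xi>.
        (\<forall>m. simple_integrand F a b (n m) (\<tau> m) (\<xi> m)) \<and>
        (\<lambda>m. \<integral>\<^sup>+ \<omega>. (\<integral>\<^sup>+ s\<in>{a..b}.
            ennreal ((norm (X s \<omega> - step_fun (n m) (\<tau> m) (\<xi> m) s \<omega>))\<^sup>2) \<partial>lborel) \<partial>M)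
          \<longlonglongrightarrow> 0 \<and>
        (\<lambda>m. \<integral>\<^sup>+ \<omega>.
            ennreal ((norm (I \<omega> - elementary_integral W (n m) (\<tau> m) (\<xi> m) \<omega>))\<^sup>2) \<partial>M)
          \<longlonglongrightarrow> 0)"


section \<open>Stochastic master equation\<close>

definition sme_drift :: "'n::finite cmat \<Rightarrow> 'n cmat \<Rightarrow> 'n cmat \<Rightarrow> 'n cmat" where
  "sme_drift H L A =
     cscale (- \<i>) (commutator H A) + L ** A ** dagger L
     - cscale (1 / 2) (anticommutator (dagger L ** L) A)"

definition sme_diffusion :: "real \<Rightarrow> 'n::finite cmat \<Rightarrow> 'n cmat \<Rightarrow> 'n cmat" where
  "sme_diffusion \<eta> L A =
     sqrt \<eta> *\<^sub>R (L ** A + A ** dagger L - cscale (trace ((L + dagger L) ** A)) A)"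

text \<open>Density-matrix-valued, adapted, continuous solutions, from time \<open>t\<close> and state \<open>A\<close> on, of the
  stochastic master equation with time-dependent Hamiltonian \<open>H\<close>.\<close>

definition sme_solution ::
    "'w measure \<Rightarrow> (real \<Rightarrow> 'w measure) \<Rightarrow> (real \<Rightarrow> 'w \<Rightarrow> real) \<Rightarrow> real \<Rightarrow>
     (real \<Rightarrow> 'n::finite cmat) \<Rightarrow> 'n cmat \<Rightarrow> real \<Rightarrow> 'n cmat \<Rightarrow>
     (real \<Rightarrow> 'w \<Rightarrow> 'n cmat) \<Rightarrow> bool" where
  "sme_solution M F W \<eta> H L t A \<rho> \<longleftrightarrow>
     (\<forall>s\<ge>t. \<rho> s \<in> borel_measurable (F s)) \<and>
     (\<forall>\<omega>\<in>space M. continuous_on {t..} (\<lambda>s. \<rho> s \<omega>)) \<and>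
     (\<forall>\<omega>\<in>space M. \<forall>s\<ge>t. density_matrix (\<rho> s \<omega>)) \<and>
     (AE \<omega> in M. \<rho> t \<omega> = A) \<and>
     (\<forall>s\<ge>t. \<exists>I. has_ito_integral M F W t s (\<lambda>r \<omega>. sme_diffusion \<eta> L (\<rho> r \<omega>)) I \<and>
        (AE \<omega> in M.
           integrable (lebesgue_on {t..s}) (\<lambda>r. sme_drift (H r) L (\<rho> r \<omega>)) \<and>
           \<rho> s \<omega> = A + (LINT r|lebesgue_on {t..s}. sme_drift (H r) L (\<rho> r \<omega>)) + I \<omega>))"


section \<open>Controls and costs\<close>

text \<open>Only the values of a control on \<open>[t, t + \<Delta>]\<close> matter.\<close>

definition admissible_control :: "real set \<Rightarrow> real \<Rightarrow> real \<Rightarrow> (real \<Rightarrow> real) \<Rightarrow> bool" where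
  "admissible_control U t \<Delta> u \<longleftrightarrow>
     u \<in> borel_measurable (lebesgue_on {t..t + \<Delta>}) \<and>
     bounded (u ` {t..t + \<Delta>}) \<and> u ` {t..t + \<Delta>} \<subseteq> U"

definition switched_off :: "real \<Rightarrow> real \<Rightarrow> (real \<Rightarrow> real) \<Rightarrow> real \<Rightarrow> real" where
  "switched_off t \<Delta> u s = (if s \<in> {t..t + \<Delta>} then u s else 0)"

definition average_cost ::
    "'w measure \<Rightarrow> real \<Rightarrow> 'n::finite cmat \<Rightarrow> (real \<Rightarrow> 'w \<Rightarrow> 'n cmat) \<Rightarrow> real \<Rightarrow> real" where
  "average_cost M t B \<rho> T =
     1 / T * (LINT \<omega>|M. (LINT s|lebesgue_on {t..T}. (bures_dist (\<rho> s \<omega>) B)\<^sup>2))"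

text \<open>\<open>Lim\<close> is unspecified if the limit does not exist.\<close>

definition infinite_horizon_cost ::
    "'w measure \<Rightarrow> real \<Rightarrow> 'n::finite cmat \<Rightarrow> (real \<Rightarrow> 'w \<Rightarrow> 'n cmat) \<Rightarrow> real" where
  "infinite_horizon_cost M t B \<rho> = Lim at_top (average_cost M t B \<rho>)"

definition mean_state :: "'w measure \<Rightarrow> (real \<Rightarrow> 'w \<Rightarrow> 'n::finite cmat) \<Rightarrow> real \<Rightarrow> 'n cmat" where
  "mean_state M \<rho> s = (LINT \<omega>|M. \<rho> s \<omega>)"

definition terminal_cost ::
    "'w measure \<Rightarrow> real \<Rightarrow> 'n::finite cmat \<Rightarrow> (real \<Rightarrow> 'w \<Rightarrow> 'n cmat) \<Rightarrow> real" where
  "terminal_cost M s B \<rho> = 2 * (1 - Re (trace (mean_state M \<rho> s ** B)))"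

end

theory Submission
  imports Defs
begin

text \<open>
  Because \<open>J\<^sub>z\<close> has simple spectrum, \<open>\<rho>\<^sub>f\<close> is a projector \<open>|k\<rangle>\<langle>k|\<close> of the standard basis, and then
  \<open>d\<^sub>B\<^sup>2 = 2 - 2 * sqrt p\<close> with \<open>p\<close> the \<open>k\<close>-th diagonal entry of the state.  Once the control is off, the
  diagonal has no drift: \<open>p\<close> has constant mean, and \<open>m = Tr (L \<rho>)\<close> is a bounded martingale whose
  diffusion coefficient is \<open>2 * sqrt \<eta> * V\<close>, where \<open>V\<close> is the variance of the spectrum under the
  populations.  The Ito isometry bounds \<open>E (\<integral> V\<^sup>2)\<close> over an infinite horizon.  Eigenvalue gaps are at least
  one, so \<open>V \<ge> p * (1 - p) \<ge> (sqrt p - p)\<^sup>2\<close>; hence \<open>sqrt p - p\<close> vanishes in time average, and the average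
  of \<open>2 - 2 * sqrt p\<close> tends to \<open>2 * (1 - E p)\<close>.
\<close>

section \<open>Populations of density matrices\<close>

text \<open>Convergence of individual trajectories is never addressed; everything is done with
  expected time integrals. The squared distance splits as 2 * (1 - p) - 2 * (sqrt p - p): the first
  part is linear in the state and follows from a constant mean, the second is the error to be
  averaged away. The variance V is accessible because it is the diffusion coefficient of a
  functional m that is itself linear in the state, so no nonlinear function of the state has to be
  expanded by the Ito formula. The price is that only V^2, and with it (sqrt p - p)^4, has a bounded
  total integral; \<open>le_add_power4_div\<close> turns this into a vanishing average. The obstacle
  is that a solution comes only with mean-square Ito integrals starting at \<open>t\<close>.
  Increments after the control phase are therefore differences of two such integrals, and the
  control phase itself, where m may drift, contributes a finite constant that does not depend on the
  horizon.\<close>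

definition population :: "'n::finite cmat \<Rightarrow> 'n \<Rightarrow> real" where
  "population A k = Re (A $ k $ k)"

definition real_diag :: "('n::finite \<Rightarrow> real) \<Rightarrow> 'n cmat" where
  "real_diag d = (\<chi> k l. if k = l then complex_of_real (d k) else 0)"

definition basis_proj :: "'n::finite \<Rightarrow> 'n cmat" where
  "basis_proj k = ketbra (axis k 1) (axis k 1)"

lemma basis_proj_nth: "basis_proj k $ i $ l = (if i = k \<and> l = k then 1 else 0)"
  by (auto simp: basis_proj_def ketbra_def axis_def)

lemma bounded_linear_population: "bounded_linear (\<lambda>A. population A k)"
  unfolding population_def
  by (intro bounded_linear_compose[OF bounded_linear_Re] bounded_linear_compose[OF bounded_linear_vec_nth]
      bounded_linear_vec_nth)

lemma sum_axis_mult: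
  fixes g :: "'n::finite \<Rightarrow> complex"
  shows "(\<Sum>i\<in>UNIV. g i * axis k c $ i) = g k * c" "(\<Sum>i\<in>UNIV. cnj (axis k c $ i) * g i) = cnj c * g k"
proof -
  have "(\<Sum>i\<in>UNIV. g i * axis k c $ i) = (\<Sum>i\<in>UNIV. if i = k then g k * c else 0)"
    by (intro sum.cong) (auto simp: axis_def)
  then show "(\<Sum>i\<in>UNIV. g i * axis k c $ i) = g k * c"
    by simp
  have "(\<Sum>i\<in>UNIV. cnj (axis k c $ i) * g i) = (\<Sum>i\<in>UNIV. if i = k then cnj c * g k else 0)"
    by (intro sum.cong) (auto simp: axis_def)
  then show "(\<Sum>i\<in>UNIV. cnj (axis k c $ i) * g i) = cnj c * g k"
    by simp
qed

lemma braket_axis: "braket (axis i c) (A *v axis l d) = cnj c * A $ i $ l * d"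
  by (simp add: braket_def matrix_vector_mult_def sum_axis_mult)

lemma braket_add_left: "braket (v + w) x = braket v x + braket w x"
  by (simp add: braket_def algebra_simps sum.distrib)

lemma braket_add_right: "braket x (v + w) = braket x v + braket x w"
  by (simp add: braket_def algebra_simps sum.distrib)

lemma hermitian_nth: "hermitian A \<Longrightarrow> A $ l $ i = cnj (A $ i $ l)"
  unfolding hermitian_def dagger_def by (metis vec_lambda_beta)

lemma hermitian_diag: "hermitian A \<Longrightarrow> A $ k $ k = complex_of_real (population A k)"
  unfolding population_def using hermitian_nth[of A k k]
  by (metis Reals_cnj_iff of_real_Re)

lemma psd_population_nonneg: "psd A \<Longrightarrow> 0 \<le> population A k"
  using braket_axis[of k 1 A k 1] by (auto simp: psd_def population_def dest: spec[of _ "axis k 1"])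

text \<open>Positivity is tested on \<open>axis i 1 + axis l c\<close> with a phase
  \<open>c\<close>. This even yields half of the stated bound; any bound by populations
  serves.\<close>

lemma psd_offdiag_bound:
  assumes "psd A"
  shows "\<bar>Re (A $ i $ l)\<bar> \<le> population A i + population A l"
    and "\<bar>Im (A $ i $ l)\<bar> \<le> population A i + population A l"
proof -
  have herm: "A $ l $ i = cnj (A $ i $ l)"
    using assms hermitian_nth unfolding psd_def by blast
  have pos: "0 \<le> Re (A $ i $ i + A $ i $ l * c + cnj c * A $ l $ i + cnj c * A $ l $ l * c)" for c
  proof -
    have "0 \<le> Re (braket (axis i 1 + axis l c) (A *v (axis i 1 + axis l c)))"
      using assms unfolding psd_def by blast
    then show ?thesis
      by (simp only: braket_add_left braket_add_right matrix_vector_right_distrib braket_axis) simp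
  qed
  have "0 \<le> population A i + population A l + 2 * Re (A $ i $ l * c)" if "cmod c = 1" for c
  proof -
    have "cnj c * A $ l $ i = cnj (A $ i $ l * c)"
      by (simp add: herm)
    moreover have "cnj c * A $ l $ l * c = A $ l $ l"
      using that complex_norm_square[of c] by (simp add: mult_ac)
    ultimately have "0 \<le> Re (A $ i $ i + A $ i $ l * c + cnj (A $ i $ l * c) + A $ l $ l)"
      using pos[of c] by (simp only:)
    then show ?thesis
      by (simp add: population_def algebra_simps)
  qed
  \<comment> \<open>The four phases isolate plus and minus the real and the imaginary part of the
    entry.\<close>
  from this[of 1] this[of "-1"] this[of \<i>] this[of "-\<i>"]
  show "\<bar>Re (A $ i $ l)\<bar> \<le> population A i + population A l"
    and "\<bar>Im (A $ i $ l)\<bar> \<le> population A i + population A l"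
    using psd_population_nonneg[OF assms, of i] psd_population_nonneg[OF assms, of l]
    by (simp_all add: abs_le_iff)
qed

lemma density_population_sum: "density_matrix A \<Longrightarrow> (\<Sum>k\<in>UNIV. population A k) = 1"
  unfolding density_matrix_def population_def trace_def by (metis Re_sum one_complex.simps(1))

lemma density_population_bounds:
  assumes "density_matrix A"
  shows "0 \<le> population A k" "population A k \<le> 1"
proof -
  have nn: "0 \<le> population A l" for l
    using assms by (auto simp: density_matrix_def psd_population_nonneg)
  then show "0 \<le> population A k" .
  show "population A k \<le> 1"
    using member_le_sum[of k UNIV "population A"] nn density_population_sum[OF assms] by simp
qed

text \<open>Real and imaginary parts are at most 2 each, and there are \<open>CARD('n)\<close>
  squared entries. The constant is crude; what counts is uniformity in time and noise, which makes
  states integrable and linear functionals of them bounded.\<close>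

lemma density_norm_bound:
  fixes A :: "'n::finite cmat"
  assumes "density_matrix A"
  shows "norm A \<le> 4 * (real CARD('n))\<^sup>2"
proof -
  have entry: "norm (A $ i $ l) \<le> 4" for i l
  proof -
    have psd: "psd A"
      using assms by (simp add: density_matrix_def)
    have "norm (A $ i $ l) \<le> \<bar>Re (A $ i $ l)\<bar> + \<bar>Im (A $ i $ l)\<bar>"
      by (rule cmod_le)
    also have "\<dots> \<le> 4"
      using psd_offdiag_bound[OF psd, of i l] density_population_bounds(2)[OF assms, of i]
        density_population_bounds(2)[OF assms, of l] by linarith
    finally show ?thesis .
  qed
  have row: "norm (A $ i) \<le> real CARD('n) * 4" for i
  proof -
    have "norm (A $ i) \<le> (\<Sum>l\<in>UNIV. norm (A $ i $ l))"
      unfolding norm_vec_def by (rule L2_set_le_sum) simp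
    also have "\<dots> \<le> real CARD('n) * 4"
      by (rule sum_bounded_above) (rule entry)
    finally show ?thesis .
  qed
  have "norm A \<le> (\<Sum>i\<in>UNIV. norm (A $ i))"
    unfolding norm_vec_def by (rule L2_set_le_sum) simp
  also have "\<dots> \<le> real CARD('n) * (real CARD('n) * 4)"
    by (rule sum_bounded_above) (rule row)
  finally show ?thesis
    by (simp add: power2_eq_square mult_ac)
qed

section \<open>Square roots and the Bures distance to a basis projector\<close>

lemma psd_scaled_basis_proj:
  assumes "0 \<le> c"
  shows "psd (c *\<^sub>R basis_proj k)"
proof -
  have "braket v ((c *\<^sub>R basis_proj k) *v v) = of_real c * (cnj (v $ k) * v $ k)" for v
  proof -
    have "((c *\<^sub>R basis_proj k) *v v) $ i = (if i = k then of_real c * v $ k else 0)" for i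
    proof -
      have "((c *\<^sub>R basis_proj k) *v v) $ i = (\<Sum>l\<in>UNIV. if l = k then (if i = k then of_real c * v $ k else 0) else 0)"
        unfolding matrix_vector_mult_def vec_lambda_beta
        by (intro sum.cong) (auto simp: basis_proj_nth scaleR_conv_of_real[where 'a=complex])
      then show ?thesis by simp
    qed
    then have "braket v ((c *\<^sub>R basis_proj k) *v v) = (\<Sum>i\<in>UNIV. if i = k then of_real c * (cnj (v $ k) * v $ k) else 0)"
      unfolding braket_def by (intro sum.cong) auto
    then show ?thesis by simp
  qed
  moreover have "hermitian (c *\<^sub>R basis_proj k)"
    by (auto simp: hermitian_def dagger_def vec_eq_iff basis_proj_nth)
  ultimately show ?thesis
    using assms by (simp add: psd_def)
qed

lemma basis_proj_sandwich: "basis_proj k ** A ** basis_proj k = cscale (A $ k $ k) (basis_proj k)"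
proof -
  have 1: "(basis_proj k ** A) $ i $ l = (if i = k then A $ k $ l else 0)" for i l
  proof -
    have "(basis_proj k ** A) $ i $ l = (\<Sum>m\<in>UNIV. if m = k then (if i = k then A $ k $ l else 0) else 0)"
      unfolding matrix_matrix_mult_def vec_lambda_beta by (intro sum.cong) (auto simp: basis_proj_nth)
    then show ?thesis by simp
  qed
  have "(basis_proj k ** A ** basis_proj k) $ i $ l = (\<Sum>m\<in>UNIV. if m = k then (if i = k \<and> l = k then A $ k $ k else 0) else 0)" for i l
    unfolding matrix_matrix_mult_def[of "basis_proj k ** A"] vec_lambda_beta
    by (intro sum.cong) (auto simp: basis_proj_nth 1)
  then show ?thesis
    by (auto simp: vec_eq_iff cscale_def basis_proj_nth)
qed

lemma basis_proj_idem: "basis_proj k ** basis_proj k = basis_proj k"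
proof -
  have "(basis_proj k ** basis_proj k) $ i $ l = (\<Sum>m\<in>UNIV. if m = k then basis_proj k $ i $ l else 0)" for i l
    unfolding matrix_matrix_mult_def vec_lambda_beta by (intro sum.cong) (auto simp: basis_proj_nth)
  then show ?thesis by (simp add: vec_eq_iff)
qed

text \<open>For Hermitian \<open>B\<close> the square is \<open>B ** dagger B\<close>, whose
  diagonal holds the squared lengths of the rows.\<close>

lemma hermitian_square_diag:
  assumes "hermitian B"
  shows "(B ** B) $ i $ i = complex_of_real (\<Sum>l\<in>UNIV. (cmod (B $ i $ l))\<^sup>2)"
proof -
  have "B $ i $ l * B $ l $ i = complex_of_real ((cmod (B $ i $ l))\<^sup>2)" for l
    using hermitian_nth[OF assms, of l i] by (simp add: complex_norm_square[symmetric])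
  then show ?thesis
    by (simp add: matrix_matrix_mult_def)
qed

lemma scaleR_matrix_mult: "(a *\<^sub>R A) ** (b *\<^sub>R B) = (a * b) *\<^sub>R (A ** (B :: 'n::finite cmat))"
  by (simp add: vec_eq_iff matrix_matrix_mult_def scaleR_sum_right mult.commute)

text \<open>A positive root of \<open>c |k\<rangle>\<langle>k|\<close> is Hermitian, so the zero diagonal entries of its square kill
  whole rows and columns.\<close>

lemma msqrt_scaled_basis_proj:
  assumes "0 \<le> c"
  shows "msqrt (c *\<^sub>R basis_proj k) = sqrt c *\<^sub>R basis_proj k"
  unfolding msqrt_def
proof (rule the_equality)
  show "psd (sqrt c *\<^sub>R basis_proj k) \<and>
      (sqrt c *\<^sub>R basis_proj k) ** (sqrt c *\<^sub>R basis_proj k) = c *\<^sub>R basis_proj k"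
    using assms by (simp add: psd_scaled_basis_proj scaleR_matrix_mult basis_proj_idem)
next
  fix B assume B: "psd B \<and> B ** B = c *\<^sub>R basis_proj k"
  then have herm: "hermitian B" by (simp add: psd_def)
  have sq: "(\<Sum>l\<in>UNIV. (cmod (B $ i $ l))\<^sup>2) = (if i = k then c else 0)" for i
  proof -
    have "complex_of_real (\<Sum>l\<in>UNIV. (cmod (B $ i $ l))\<^sup>2) = (c *\<^sub>R basis_proj k) $ i $ i"
      using hermitian_square_diag[OF herm, of i] B by simp
    also have "\<dots> = complex_of_real (if i = k then c else 0)"
      by (simp add: basis_proj_nth of_real_def)
    finally show ?thesis by (simp only: of_real_eq_iff)
  qed
  have row: "B $ i $ l = 0" if "i \<noteq> k" for i l
    using sq[of i] that by (simp add: sum_nonneg_eq_0_iff)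
  then have col: "B $ i $ l = 0" if "l \<noteq> k" for i l
    using hermitian_nth[OF herm, of i l] that by simp
  have "(\<Sum>l\<in>UNIV. (cmod (B $ k $ l))\<^sup>2) = (\<Sum>l\<in>UNIV. if l = k then (cmod (B $ k $ k))\<^sup>2 else 0)"
    by (intro sum.cong) (auto simp: col)
  then have "(cmod (B $ k $ k))\<^sup>2 = c"
    using sq[of k] by simp
  moreover have "cmod (B $ k $ k) = population B k"
    using hermitian_diag[OF herm, of k] psd_population_nonneg[of B k] B by simp
  ultimately have "population B k = sqrt c"
    by (metis norm_ge_zero real_sqrt_unique)
  then have "B $ k $ k = of_real (sqrt c)"
    using hermitian_diag[OF herm] by simp
  then show "B = sqrt c *\<^sub>R basis_proj k"
    using row col by (auto simp: vec_eq_iff basis_proj_nth of_real_def)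
qed

lemma trace_mult_basis_proj: "trace (A ** basis_proj k) = A $ k $ k"
proof -
  have "(A ** basis_proj k) $ i $ i = (\<Sum>m\<in>UNIV. if m = k then (if i = k then A $ k $ k else 0) else 0)" for i
    unfolding matrix_matrix_mult_def vec_lambda_beta by (intro sum.cong) (auto simp: basis_proj_nth)
  then show ?thesis by (simp add: trace_def)
qed

text \<open>The projector is its own root and compresses the state to \<open>population A k\<close>
  times itself, so the fidelity is the root of that population. Being at most 1, it keeps the
  argument of the outer root nonnegative, and squaring undoes that root.\<close>

lemma bures_dist_basis_proj:
  assumes "density_matrix A"
  shows "(bures_dist A (basis_proj k))\<^sup>2 = 2 - 2 * sqrt (population A k)"
proof -
  have herm: "hermitian A"
    using assms by (simp add: density_matrix_def psd_def)
  have root: "msqrt (basis_proj k) = basis_proj k"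
    using msqrt_scaled_basis_proj[of 1 k] by simp
  have "basis_proj k ** A ** basis_proj k = population A k *\<^sub>R basis_proj k"
    unfolding basis_proj_sandwich hermitian_diag[OF herm]
    by (simp add: cscale_def vec_eq_iff scaleR_conv_of_real[where 'a=complex])
  then have "msqrt (msqrt (basis_proj k) ** A ** msqrt (basis_proj k))
      = sqrt (population A k) *\<^sub>R basis_proj k"
    using density_population_bounds(1)[OF assms] by (simp add: root msqrt_scaled_basis_proj)
  moreover have "trace (sqrt (population A k) *\<^sub>R basis_proj k) = of_real (sqrt (population A k))"
    by (simp add: trace_def basis_proj_nth of_real_def if_distrib cong: if_cong)
  moreover have "sqrt (population A k) \<le> 1"
    using density_population_bounds(2)[OF assms] by simp
  ultimately show ?thesis
    by (simp add: bures_dist_def)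
qed

section \<open>Populations under a diagonal Hamiltonian and measurement operator\<close>

lemma real_diag_mult_nth:
  "(real_diag d ** A) $ i $ l = of_real (d i) * A $ i $ l"
  "(A ** real_diag d) $ i $ l = A $ i $ l * of_real (d l)"
proof -
  have "(real_diag d ** A) $ i $ l = (\<Sum>m\<in>UNIV. if m = i then of_real (d i) * A $ i $ l else 0)"
    unfolding matrix_matrix_mult_def vec_lambda_beta by (intro sum.cong) (auto simp: real_diag_def)
  then show "(real_diag d ** A) $ i $ l = of_real (d i) * A $ i $ l" by simp
  have "(A ** real_diag d) $ i $ l = (\<Sum>m\<in>UNIV. if m = l then A $ i $ l * of_real (d l) else 0)"
    unfolding matrix_matrix_mult_def vec_lambda_beta by (intro sum.cong) (auto simp: real_diag_def)
  then show "(A ** real_diag d) $ i $ l = A $ i $ l * of_real (d l)" by simp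
qed

lemma dagger_real_diag: "dagger (real_diag d) = real_diag d"
  by (auto simp: dagger_def real_diag_def vec_eq_iff)

text \<open>A commutator with a diagonal matrix has zero diagonal, and the gain \<open>d k\<close>
  squared times the entry balances the loss from the anticommutator.\<close>

lemma population_drift_diag: "population (sme_drift (real_diag d) (real_diag d) A) k = 0"
proof -
  \<comment> \<open>Reassociated so that the entry formulas for a diagonal factor apply
    twice.\<close>
  have "((real_diag d ** real_diag d) ** A) $ k $ k = (real_diag d ** (real_diag d ** A)) $ k $ k"
    "(A ** (real_diag d ** real_diag d)) $ k $ k = ((A ** real_diag d) ** real_diag d) $ k $ k"
    by (simp_all only: matrix_mul_assoc)
  then show ?thesis
    by (simp add: population_def sme_drift_def commutator_def anticommutator_def cscale_def
        dagger_real_diag real_diag_mult_nth)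
qed

lemma matrix_add_rdistrib_cmat: "(A + B) ** C = A ** C + B ** (C :: 'n::finite cmat)"
  by (simp add: vec_eq_iff matrix_matrix_mult_def algebra_simps sum.distrib)

text \<open>The nonlinear trace term subtracts the population mean of \<open>d\<close>, so each
  population is driven in proportion to the deviation of its eigenvalue from that mean; weighting
  with \<open>d\<close> and summing then gives a variance.\<close>

lemma population_diffusion_diag:
  assumes "hermitian A"
  shows "population (sme_diffusion \<eta> (real_diag d) A) k
    = 2 * sqrt \<eta> * (d k - (\<Sum>l\<in>UNIV. d l * population A l)) * population A k"
proof -
  have "trace ((real_diag d + real_diag d) ** A) = of_real (2 * (\<Sum>l\<in>UNIV. d l * population A l))" (is "?t = _")
    unfolding trace_def matrix_add_rdistrib_cmat
    by (simp add: real_diag_mult_nth hermitian_diag[OF assms] sum.distrib sum_distrib_left)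
  then have "cscale ?t A $ k $ k = of_real (2 * (\<Sum>l\<in>UNIV. d l * population A l) * population A k)"
    unfolding cscale_def by (simp add: hermitian_diag[OF assms])
  moreover have "(real_diag d ** A + A ** real_diag d) $ k $ k = of_real (2 * d k * population A k)"
    by (simp add: real_diag_mult_nth hermitian_diag[OF assms])
  ultimately have "(real_diag d ** A + A ** real_diag d - cscale ?t A) $ k $ k
      = of_real (2 * d k * population A k - 2 * (\<Sum>l\<in>UNIV. d l * population A l) * population A k)"
    by (simp only: vector_minus_component of_real_diff)
  moreover have "population (sme_diffusion \<eta> (real_diag d) A) k
      = sqrt \<eta> * Re ((real_diag d ** A + A ** real_diag d - cscale ?t A) $ k $ k)"
    unfolding sme_diffusion_def dagger_real_diag by (simp add: population_def)
  ultimately have "population (sme_diffusion \<eta> (real_diag d) A) k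
      = sqrt \<eta> * (2 * d k * population A k - 2 * (\<Sum>l\<in>UNIV. d l * population A l) * population A k)"
    by (simp only: Re_complex_of_real)
  then show ?thesis
    by (simp add: algebra_simps)
qed

text \<open>Centre the spectrum at \<open>d k\<close>, so that index \<open>k\<close> contributes to
  neither moment. With Q and m the second and first moment over the other indices, Cauchy-Schwarz
  gives m^2 \<le> (1 - a k) * Q, hence variance Q - m^2 \<ge> a k * Q, and the gap gives Q \<ge> 1 -
  a k.\<close>

lemma mult_complement_le_variance:
  fixes a d :: "'i \<Rightarrow> real"
  assumes fin: "finite S" and k: "k \<in> S" and nn: "\<And>i. i \<in> S \<Longrightarrow> 0 \<le> a i" and sum: "(\<Sum>i\<in>S. a i) = 1"
    and gap: "\<And>i. i \<in> S \<Longrightarrow> i \<noteq> k \<Longrightarrow> 1 \<le> \<bar>d i - d k\<bar>"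
  shows "a k * (1 - a k) \<le> (\<Sum>i\<in>S. (d i)\<^sup>2 * a i) - (\<Sum>i\<in>S. d i * a i)\<^sup>2"
proof -
  define e where "e = (\<lambda>i. d i - d k)"
  define R where "R = S - {k}"
  define Q where "Q = (\<Sum>i\<in>R. a i * (e i)\<^sup>2)"
  define m where "m = (\<Sum>i\<in>R. a i * e i)"
  have rest: "(\<Sum>i\<in>R. a i) = 1 - a k"
    using sum fin k by (simp add: R_def sum_diff1)
  have nnR: "0 \<le> a i" if "i \<in> R" for i
    using that nn by (simp add: R_def)
  \<comment> \<open>Half of each weight goes to either factor, so that one of the sums in
    Cauchy-Schwarz is the total weight 1 - a k.\<close>
  have "m\<^sup>2 = (\<Sum>i\<in>R. sqrt (a i) * (sqrt (a i) * e i))\<^sup>2"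
    unfolding m_def by (intro arg_cong[where f="\<lambda>x. x\<^sup>2"] sum.cong) (auto simp: nnR)
  also have "\<dots> \<le> (\<Sum>i\<in>R. (sqrt (a i))\<^sup>2) * (\<Sum>i\<in>R. (sqrt (a i) * e i)\<^sup>2)"
    by (rule Cauchy_Schwarz_ineq_sum)
  also have "\<dots> = (1 - a k) * Q"
    unfolding rest[symmetric] Q_def by (simp add: nnR power_mult_distrib)
  finally have CS: "m\<^sup>2 \<le> (1 - a k) * Q" .
  have "1 \<le> (e i)\<^sup>2" if "i \<in> R" for i
    using gap[of i] that by (simp add: R_def e_def abs_le_square_iff[of 1, simplified])
  then have "(\<Sum>i\<in>R. a i * 1) \<le> Q"
    unfolding Q_def using nnR by (intro sum_mono mult_left_mono) auto
  then have Q1: "a k * (1 - a k) \<le> a k * Q"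
    using nn[OF k] by (intro mult_left_mono) (auto simp: rest)
  have q: "(\<Sum>i\<in>S. a i * (e i)\<^sup>2) = Q" "(\<Sum>i\<in>S. a i * e i) = m"
    using fin k by (auto simp: Q_def m_def R_def sum.remove e_def)
  have "m = (\<Sum>i\<in>S. d i * a i) - d k"
    unfolding q(2)[symmetric] e_def
    by (simp add: algebra_simps sum_subtractf) (simp add: sum flip: sum_distrib_right)
  moreover have "Q = (\<Sum>i\<in>S. (d i)\<^sup>2 * a i) - 2 * d k * (\<Sum>i\<in>S. d i * a i) + (d k)\<^sup>2"
  proof -
    have "Q = (\<Sum>i\<in>S. (d i)\<^sup>2 * a i - 2 * d k * (d i * a i) + (d k)\<^sup>2 * a i)"
      unfolding q(1)[symmetric] e_def by (intro sum.cong) (auto simp: power2_eq_square algebra_simps)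
    then show ?thesis
      by (simp add: sum.distrib sum_subtractf sum flip: sum_distrib_left)
  qed
  ultimately have "(\<Sum>i\<in>S. (d i)\<^sup>2 * a i) - (\<Sum>i\<in>S. d i * a i)\<^sup>2 = Q - m\<^sup>2"
 (is "?A - ?B\<^sup>2 = _")
  proof -
    assume "m = ?B - d k" "Q = ?A - 2 * d k * ?B + (d k)\<^sup>2"
    moreover have "A - B\<^sup>2 = A - 2 * c * B + c\<^sup>2 - (B - c)\<^sup>2" for A B c :: real
      by (simp add: power2_eq_square algebra_simps)
    ultimately show ?thesis by metis
  qed
  then show ?thesis
    using CS Q1 by (simp add: algebra_simps)
qed

section \<open>Spectrum and eigenvectors of \<open>J\<^sub>z\<close>\<close>

lemma J\<^sub>z_real_diag: "J\<^sub>z j = real_diag (\<lambda>k. j - real (card {..<k}))"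
  by (simp add: J\<^sub>z_def real_diag_def)

lemma card_lessThan_gap:
  fixes i k :: "'n::{finite, linorder}"
  assumes "i \<noteq> k"
  shows "1 \<le> \<bar>real (card {..<i}) - real (card {..<k})\<bar>"
proof -
  have lt: "card {..<x} < card {..<y}" if "x < y" for x y :: 'n
    using that by (intro psubset_card_mono) auto
  from assms consider "i < k" | "k < i" by fastforce
  then show ?thesis
    by cases (use lt[of i k] lt[of k i] in auto)
qed

text \<open>Simplicity of the spectrum confines the eigenvector to one coordinate; normalisation
  fixes it up to a phase, and the phase cancels in the outer product.\<close>

lemma ketbra_eigenvector:
  fixes v :: "'n::finite cvec"
  assumes inj: "inj d" and eig: "real_diag d *v v = complex_of_real c *s v" and unit: "braket v v = 1"
  obtains k where "ketbra v v = basis_proj k"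
proof -
  have comp: "of_real (d i) * v $ i = of_real c * v $ i" for i
  proof -
    have "(real_diag d *v v) $ i = (\<Sum>m\<in>UNIV. if m = i then of_real (d i) * v $ i else 0)"
      unfolding matrix_vector_mult_def vec_lambda_beta by (intro sum.cong) (auto simp: real_diag_def)
    then have "(real_diag d *v v) $ i = of_real (d i) * v $ i" by simp
    then show ?thesis unfolding eig by auto
  qed
  have "\<exists>k. v $ k \<noteq> 0"
    using unit by (auto simp: braket_def intro: ccontr)
  then obtain k where k: "v $ k \<noteq> 0" by blast
  have zero: "v $ i = 0" if "i \<noteq> k" for i
    using comp[of i] comp[of k] k injD[OF inj, of i k] that by auto
  have "braket v v = (\<Sum>i\<in>UNIV. if i = k then cnj (v $ k) * v $ k else 0)"
    unfolding braket_def by (intro sum.cong) (auto simp: zero)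
  then have "v $ k * cnj (v $ k) = 1"
    using unit by (simp add: mult.commute)
  then have "ketbra v v = basis_proj k"
    by (auto simp: vec_eq_iff ketbra_def basis_proj_nth zero)
  then show thesis by (rule that)
qed


section \<open>Ito integrals in mean square\<close>

locale wiener =
  fixes M :: "'w measure" and F :: "real \<Rightarrow> 'w measure" and W :: "real \<Rightarrow> 'w \<Rightarrow> real"
  assumes wiener: "wiener_process M F W"

sublocale wiener \<subseteq> prob_space M
  using wiener by (simp add: wiener_process_def)

section \<open>Independence and moments of Wiener increments\<close>

context wiener
begin

lemma subalgebra_F: "subalgebra M (F s)"
  using wiener by (simp add: wiener_process_def)

lemma space_F: "space (F s) = space M"
  using subalgebra_F[of s] by (simp add: subalgebra_def)

lemma measurable_F_M: "f \<in> borel_measurable (F s) \<Longrightarrow> f \<in> borel_measurable M"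
  using measurable_from_subalg[OF subalgebra_F] .

lemma measurable_F_mono:
  assumes "r \<le> s" "f \<in> borel_measurable (F r)"
  shows "f \<in> borel_measurable (F s)"
proof -
  have "filtration (space M) F"
    using wiener by (simp add: wiener_process_def)
  then have "subalgebra (F s) (F r)"
    using assms(1) by (simp add: subalgebra_def filtration_def)
  then show ?thesis
    using assms(2) measurable_from_subalg by blast
qed

lemma W_measurable_F: "0 \<le> s \<Longrightarrow> W s \<in> borel_measurable (F s)"
  using wiener by (simp add: wiener_process_def)

text \<open>The sigma-algebra generated by \<open>Z\<close> lies inside \<open>F r\<close>, so
  independence is inherited from the whole past.\<close>

lemma indep_var_increment:
  fixes Z :: "'w \<Rightarrow> real"
  assumes "0 \<le> r" "r < s" "Z \<in> borel_measurable (F r)"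
  shows "indep_var borel Z borel (\<lambda>\<omega>. W s \<omega> - W r \<omega>)"
proof -
  let ?D = "\<lambda>\<omega>. W s \<omega> - W r \<omega>"
  have ind: "indep_set (sets (F r)) (sets (vimage_algebra (space M) ?D borel))"
    using wiener assms(1,2) by (simp add: wiener_process_def)
  have "{Z -` A \<inter> space M |A. A \<in> sets borel} \<subseteq> sets (F r)"
    using measurable_sets[OF assms(3)] by (auto simp: space_F)
  then have Z: "sigma_sets (space M) {Z -` A \<inter> space M |A. A \<in> sets borel} \<subseteq> sets (F r)"
    using sets.sigma_sets_subset[of _ "F r"] by (simp add: space_F)
  have "indep_set (sigma_sets (space M) {Z -` A \<inter> space M |A. A \<in> sets borel})
      (sigma_sets (space M) {?D -` A \<inter> space M |A. A \<in> sets borel})"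
    using ind Z unfolding indep_sets2_eq sets_vimage_algebra by blast
  moreover have "?D \<in> borel_measurable M"
    using measurable_F_M[OF W_measurable_F] assms(1,2) by simp
  ultimately show ?thesis
    using measurable_F_M[OF assms(3)] by (simp add: indep_var_eq)
qed

lemma increment_moments:
  assumes "0 \<le> r" "r \<le> s"
  shows "integrable M (\<lambda>\<omega>. W s \<omega> - W r \<omega>)" "expectation (\<lambda>\<omega>. W s \<omega> - W r \<omega>) = 0"
    and "integrable M (\<lambda>\<omega>. (W s \<omega> - W r \<omega>)\<^sup>2)" "expectation (\<lambda>\<omega>. (W s \<omega> - W r \<omega>)\<^sup>2) = s - r"
proof -
  let ?D = "\<lambda>\<omega>. W s \<omega> - W r \<omega>"
  have "integrable M ?D \<and> expectation ?D = 0 \<and> integrable M (\<lambda>\<omega>. (?D \<omega>)\<^sup>2) \<and> expectation (\<lambda>\<omega>. (?D \<omega>)\<^sup>2) = s - r"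
  proof (cases "r = s")
    \<comment> \<open>A Gaussian law is given only for r < s. The degenerate case must be covered as
      well, since simple integrands may have steps of length zero.\<close>
    case False
    then have pos: "0 < sqrt (s - r)" using assms by simp
    have D: "distributed M lborel ?D (normal_density 0 (sqrt (s - r)))"
      using wiener assms False by (simp add: wiener_process_def)
    have 1: "integrable M ?D"
      using distributed_integrable[OF D, of "\<lambda>x. x"] integrable_normal_moment[OF pos, of 0 1] pos by auto
    have 2: "integrable M (\<lambda>\<omega>. (?D \<omega>)\<^sup>2)"
      using distributed_integrable[OF D, of "\<lambda>x. x\<^sup>2"] integrable_normal_moment[OF pos, of 0 2] pos by auto
    have 3: "expectation ?D = 0"
      using normal_distributed_expectation[OF pos D] .
    have "variance ?D = (sqrt (s - r))\<^sup>2"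
      using normal_distributed_variance[OF pos D] .
    then have "expectation (\<lambda>\<omega>. (?D \<omega>)\<^sup>2) = s - r"
      using assms by (simp add: 3)
    then show ?thesis using 1 2 3 by blast
  qed simp
  then show "integrable M ?D" "expectation ?D = 0" "integrable M (\<lambda>\<omega>. (?D \<omega>)\<^sup>2)" "expectation (\<lambda>\<omega>. (?D \<omega>)\<^sup>2) = s - r"
    by auto
qed

text \<open>Adaptedness enters here: a factor known at time \<open>r\<close> splits off from the
  later increment and from its square. All cross terms of the isometry are killed by the vanishing
  mean.\<close>

lemma increment_mult:
  fixes Z :: "'w \<Rightarrow> real"
  assumes rs: "0 \<le> r" "r \<le> s" and Z: "Z \<in> borel_measurable (F r)" "integrable M Z"
  shows "integrable M (\<lambda>\<omega>. Z \<omega> * (W s \<omega> - W r \<omega>))"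
    and "expectation (\<lambda>\<omega>. Z \<omega> * (W s \<omega> - W r \<omega>)) = 0"
    and "integrable M (\<lambda>\<omega>. Z \<omega> * (W s \<omega> - W r \<omega>)\<^sup>2)"
    and "expectation (\<lambda>\<omega>. Z \<omega> * (W s \<omega> - W r \<omega>)\<^sup>2) = (s - r) * expectation Z"
proof -
  let ?D = "\<lambda>\<omega>. W s \<omega> - W r \<omega>"
  have "integrable M (\<lambda>\<omega>. Z \<omega> * ?D \<omega>) \<and> expectation (\<lambda>\<omega>. Z \<omega> * ?D \<omega>) = 0 \<and>
      integrable M (\<lambda>\<omega>. Z \<omega> * (?D \<omega>)\<^sup>2) \<and> expectation (\<lambda>\<omega>. Z \<omega> * (?D \<omega>)\<^sup>2) = (s - r) * expectation Z"
  proof (cases "r = s")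
    case False
    have 1: "indep_var borel Z borel ?D"
      using False rs Z by (intro indep_var_increment) auto
    \<comment> \<open>The identity on \<open>Z\<close> is inserted so that composition squares the
      increment alone.\<close>
    have "indep_var borel ((\<lambda>x. x) \<circ> Z) borel ((\<lambda>x. x\<^sup>2) \<circ> ?D)"
      using 1 by (rule indep_var_compose) auto
    then have 2: "indep_var borel Z borel (\<lambda>\<omega>. (?D \<omega>)\<^sup>2)"
      by (simp add: comp_def)
    show ?thesis
      using indep_var_integrable[OF 1 Z(2)] indep_var_lebesgue_integral[OF 1 Z(2)]
        indep_var_integrable[OF 2 Z(2)] indep_var_lebesgue_integral[OF 2 Z(2)]
        increment_moments[OF rs] by (simp add: mult.commute)
  qed simp
  then show "integrable M (\<lambda>\<omega>. Z \<omega> * ?D \<omega>)" "expectation (\<lambda>\<omega>. Z \<omega> * ?D \<omega>) = 0"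
      "integrable M (\<lambda>\<omega>. Z \<omega> * (?D \<omega>)\<^sup>2)" "expectation (\<lambda>\<omega>. Z \<omega> * (?D \<omega>)\<^sup>2) = (s - r) * expectation Z"
    by auto
qed

end

section \<open>Simple integrands and the isometry for elementary integrals\<close>

lemma simple_integrand_mono:
  assumes "simple_integrand F a b n \<tau> \<xi>" "i \<le> k" "k \<le> n"
  shows "\<tau> i \<le> \<tau> k"
  using assms(2,3)
proof (induction k rule: dec_induct)
  case (step k)
  then show ?case
    using assms(1) by (auto simp: simple_integrand_def intro: order_trans)
qed simp

lemma simple_integrand_bounds:
  assumes "simple_integrand F a b n \<tau> \<xi>" "i \<le> n"
  shows "a \<le> \<tau> i" "\<tau> i \<le> b"
  using simple_integrand_mono[OF assms(1), of 0 i] simple_integrand_mono[OF assms(1), of i n] assms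
  by (auto simp: simple_integrand_def)

lemma step_fun_eq_0:
  assumes "simple_integrand F a b n \<tau> \<xi>" "k \<le> n" "\<tau> k < s"
  shows "step_fun k \<tau> \<xi> s \<omega> = 0"
proof -
  have "s \<notin> {\<tau> i <.. \<tau> (Suc i)}" if "i < k" for i
    using simple_integrand_mono[OF assms(1), of "Suc i" k] assms that by auto
  then show ?thesis
    by (simp add: step_fun_def)
qed

lemma step_fun_square:
  fixes \<xi> :: "nat \<Rightarrow> 'w \<Rightarrow> real"
  assumes "simple_integrand F a b n \<tau> \<xi>" "k \<le> n"
  shows "(step_fun k \<tau> \<xi> s \<omega>)\<^sup>2 = (\<Sum>i<k. indicator {\<tau> i <.. \<tau> (Suc i)} s * (\<xi> i \<omega>)\<^sup>2)"
  using assms(2)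
proof (induction k)
  case (Suc k)
  have "step_fun (Suc k) \<tau> \<xi> s \<omega> = step_fun k \<tau> \<xi> s \<omega> + indicator {\<tau> k <.. \<tau> (Suc k)} s * \<xi> k \<omega>"
    by (simp add: step_fun_def)
  \<comment> \<open>Beyond \<open>\<tau> k\<close> the earlier steps have ended, and up to
    \<open>\<tau> k\<close> the new one has not begun; the cross term of the square vanishes either
    way.\<close>
  moreover have "step_fun k \<tau> \<xi> s \<omega> = 0 \<or> indicator {\<tau> k <.. \<tau> (Suc k)} s = (0::real)"
    using step_fun_eq_0[OF assms(1), of k s \<omega>] Suc.prems by (cases "\<tau> k < s") auto
  ultimately have "(step_fun (Suc k) \<tau> \<xi> s \<omega>)\<^sup>2
      = (step_fun k \<tau> \<xi> s \<omega>)\<^sup>2 + indicator {\<tau> k <.. \<tau> (Suc k)} s * (\<xi> k \<omega>)\<^sup>2"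
    by (auto simp: indicator_def)
  then show ?case
    using Suc by simp
qed (simp add: step_fun_def)

lemma nn_integral_step_fun_square:
  fixes \<xi> :: "nat \<Rightarrow> 'w \<Rightarrow> real"
  assumes S: "simple_integrand F a b n \<tau> \<xi>"
  shows "(\<integral>\<^sup>+ s\<in>{a..b}. ennreal ((step_fun n \<tau> \<xi> s \<omega>)\<^sup>2) \<partial>lborel)
    = ennreal (\<Sum>i<n. (\<tau> (Suc i) - \<tau> i) * (\<xi> i \<omega>)\<^sup>2)"
proof -
  have le: "\<tau> i \<le> \<tau> (Suc i)" if "i < n" for i
    using S that by (simp add: simple_integrand_def)
  have "ennreal ((step_fun n \<tau> \<xi> s \<omega>)\<^sup>2) * indicator {a..b} s
      = (\<Sum>i<n. ennreal ((\<xi> i \<omega>)\<^sup>2) * indicator {\<tau> i <.. \<tau> (Suc i)} s)" for s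
  proof (cases "s \<in> {a..b}")
    case True
    have "ennreal (\<Sum>i<n. indicator {\<tau> i <.. \<tau> (Suc i)} s * (\<xi> i \<omega>)\<^sup>2)
        = (\<Sum>i<n. ennreal (indicator {\<tau> i <.. \<tau> (Suc i)} s * (\<xi> i \<omega>)\<^sup>2))"
      by (simp add: sum_ennreal)
    also have "\<dots> = (\<Sum>i<n. ennreal ((\<xi> i \<omega>)\<^sup>2) * indicator {\<tau> i <.. \<tau> (Suc i)} s)"
      by (intro sum.cong) (auto simp: indicator_def)
    finally show ?thesis
      using True by (simp add: step_fun_square[OF S])
  next
    case False
    have "s \<notin> {\<tau> i <.. \<tau> (Suc i)}" if "i < n" for i
      using False simple_integrand_bounds[OF S, of i] simple_integrand_bounds[OF S, of "Suc i"] that by auto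
    then show ?thesis using False by simp
  qed
  then have "(\<integral>\<^sup>+ s\<in>{a..b}. ennreal ((step_fun n \<tau> \<xi> s \<omega>)\<^sup>2) \<partial>lborel)
      = (\<integral>\<^sup>+ s. (\<Sum>i<n. ennreal ((\<xi> i \<omega>)\<^sup>2) * indicator {\<tau> i <.. \<tau> (Suc i)} s) \<partial>lborel)"
    by (simp only:)
  also have "\<dots> = (\<Sum>i<n. \<integral>\<^sup>+ s. ennreal ((\<xi> i \<omega>)\<^sup>2) * indicator {\<tau> i <.. \<tau> (Suc i)} s \<partial>lborel)"
    by (rule nn_integral_sum) auto
  also have "\<dots> = (\<Sum>i<n. ennreal ((\<tau> (Suc i) - \<tau> i) * (\<xi> i \<omega>)\<^sup>2))"
    by (intro sum.cong) (auto simp: nn_integral_cmult_indicator le ennreal_mult mult.commute)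
  also have "\<dots> = ennreal (\<Sum>i<n. (\<tau> (Suc i) - \<tau> i) * (\<xi> i \<omega>)\<^sup>2)"
    using le by (intro sum_ennreal) auto
  finally show ?thesis .
qed

context wiener
begin

text \<open>Induction over partial sums. Measurability at \<open>\<tau> k\<close> has to be carried
  along: it makes the partial sum a factor known before the next increment.\<close>

lemma elementary_integral_moments:
  fixes \<xi> :: "nat \<Rightarrow> 'w \<Rightarrow> real"
  assumes S: "simple_integrand F a b n \<tau> \<xi>" and a: "0 \<le> a" and "k \<le> n"
  shows "elementary_integral W k \<tau> \<xi> \<in> borel_measurable (F (\<tau> k)) \<and>
    integrable M (elementary_integral W k \<tau> \<xi>) \<and> expectation (elementary_integral W k \<tau> \<xi>) = 0 \<and>
    integrable M (\<lambda>\<omega>. (elementary_integral W k \<tau> \<xi> \<omega>)\<^sup>2) \<and>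
    expectation (\<lambda>\<omega>. (elementary_integral W k \<tau> \<xi> \<omega>)\<^sup>2)
      = (\<Sum>i<k. (\<tau> (Suc i) - \<tau> i) * expectation (\<lambda>\<omega>. (\<xi> i \<omega>)\<^sup>2))"
  using assms(3)
proof (induction k)
  case 0
  then show ?case by (simp add: elementary_integral_def[abs_def])
next
  case (Suc k)
  let ?P = "elementary_integral W k \<tau> \<xi>"
  let ?D = "\<lambda>\<omega>. W (\<tau> (Suc k)) \<omega> - W (\<tau> k) \<omega>"
  have IH: "?P \<in> borel_measurable (F (\<tau> k))" "integrable M ?P" "expectation ?P = 0"
      "integrable M (\<lambda>\<omega>. (?P \<omega>)\<^sup>2)"
      "expectation (\<lambda>\<omega>. (?P \<omega>)\<^sup>2) = (\<Sum>i<k. (\<tau> (Suc i) - \<tau> i) * expectation (\<lambda>\<omega>. (\<xi> i \<omega>)\<^sup>2))"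
    using Suc by auto
  have t: "0 \<le> \<tau> k" "\<tau> k \<le> \<tau> (Suc k)"
    using simple_integrand_bounds[OF S, of k] simple_integrand_mono[OF S, of k "Suc k"] Suc.prems a by auto
  have xi: "\<xi> k \<in> borel_measurable (F (\<tau> k))"
    using S Suc.prems by (auto simp: simple_integrand_def)
  have "bounded (\<xi> k ` space M)"
    using S Suc.prems by (auto simp: simple_integrand_def space_F)
  then obtain C where C: "\<bar>\<xi> k \<omega>\<bar> \<le> C" if "\<omega> \<in> space M" for \<omega>
    by (auto simp: bounded_iff)
  have xiM: "\<xi> k \<in> borel_measurable M" "?P \<in> borel_measurable M"
    using xi IH(1) measurable_F_M by auto
  have int1: "integrable M (\<xi> k)"
    using xiM C by (intro integrable_const_bound[where B=C]) auto
  have int2: "integrable M (\<lambda>\<omega>. (\<xi> k \<omega>)\<^sup>2)"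
    using xiM C by (intro integrable_const_bound[where B="C\<^sup>2"] AE_I2) (auto simp: abs_le_square_iff[symmetric] intro: order_trans[OF _ abs_ge_self])
  \<comment> \<open>The partial sum is in general unbounded, but the integrand is bounded on each
    step.\<close>
  have int3: "integrable M (\<lambda>\<omega>. ?P \<omega> * \<xi> k \<omega>)"
  proof (rule Bochner_Integration.integrable_bound)
    show "integrable M (\<lambda>\<omega>. C * ?P \<omega>)" using IH(2) by simp
    show "AE \<omega> in M. norm (?P \<omega> * \<xi> k \<omega>) \<le> norm (C * ?P \<omega>)"
      using mult_left_mono[OF order_trans[OF C abs_ge_self] abs_ge_zero]
      by (intro AE_I2) (simp add: abs_mult mult.commute[of C])
  qed (use xiM in simp)
  have step: "elementary_integral W (Suc k) \<tau> \<xi> = (\<lambda>\<omega>. ?P \<omega> + \<xi> k \<omega> * ?D \<omega>)"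
    by (simp add: elementary_integral_def fun_eq_iff mult.commute)
  have sq: "(\<lambda>\<omega>. (elementary_integral W (Suc k) \<tau> \<xi> \<omega>)\<^sup>2)
      = (\<lambda>\<omega>. (?P \<omega>)\<^sup>2 + 2 * (?P \<omega> * \<xi> k \<omega> * ?D \<omega>) + (\<xi> k \<omega>)\<^sup>2 * (?D \<omega>)\<^sup>2)"
    unfolding step by (simp add: fun_eq_iff power2_eq_square algebra_simps)
  \<comment> \<open>The three factors handled are those of the mean, the new square and the cross
    term, in this order.\<close>
  note m1 = increment_mult[OF t xi int1]
  have "(\<lambda>\<omega>. (\<xi> k \<omega>)\<^sup>2) \<in> borel_measurable (F (\<tau> k))" using xi by simp
  note m2 = increment_mult[OF t this int2]
  have "(\<lambda>\<omega>. ?P \<omega> * \<xi> k \<omega>) \<in> borel_measurable (F (\<tau> k))" using xi IH(1) by simp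
  note m3 = increment_mult[OF t this int3]
  have "elementary_integral W (Suc k) \<tau> \<xi> \<in> borel_measurable (F (\<tau> (Suc k)))"
    unfolding step
    using measurable_F_mono[OF t(2) xi] measurable_F_mono[OF t(2) IH(1)]
      W_measurable_F[OF order_trans[OF t]] measurable_F_mono[OF t(2) W_measurable_F[OF t(1)]]
    by (intro borel_measurable_add borel_measurable_times borel_measurable_diff)
  moreover have "integrable M (elementary_integral W (Suc k) \<tau> \<xi>)"
    "expectation (elementary_integral W (Suc k) \<tau> \<xi>) = 0"
    unfolding step using IH m1 by simp_all
  moreover have "integrable M (\<lambda>\<omega>. (elementary_integral W (Suc k) \<tau> \<xi> \<omega>)\<^sup>2)"
    unfolding sq using IH m2(3) m3(1) by (intro Bochner_Integration.integrable_add integrable_mult_right) auto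
  moreover have "expectation (\<lambda>\<omega>. (elementary_integral W (Suc k) \<tau> \<xi> \<omega>)\<^sup>2)
      = (\<Sum>i<Suc k. (\<tau> (Suc i) - \<tau> i) * expectation (\<lambda>\<omega>. (\<xi> i \<omega>)\<^sup>2))"
    unfolding sq using IH m2(3,4) m3(1,2) by simp
  ultimately show ?case by blast
qed

text \<open>Both sides equal the sum of step lengths times second moments. Nonnegative extended
  integrals make the identity usable in limits without integrability conditions.\<close>

lemma elementary_integral_isometry:
  fixes \<xi> :: "nat \<Rightarrow> 'w \<Rightarrow> real"
  assumes S: "simple_integrand F a b n \<tau> \<xi>" and a: "0 \<le> a"
  shows "(\<integral>\<^sup>+ \<omega>. ennreal ((elementary_integral W n \<tau> \<xi> \<omega>)\<^sup>2) \<partial>M)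
    = (\<integral>\<^sup>+ \<omega>. (\<integral>\<^sup>+ s\<in>{a..b}. ennreal ((step_fun n \<tau> \<xi> s \<omega>)\<^sup>2) \<partial>lborel) \<partial>M)"
proof -
  have xi2: "integrable M (\<lambda>\<omega>. (\<xi> i \<omega>)\<^sup>2)" if "i < n" for i
  proof -
    have "bounded (\<xi> i ` space M)"
      using S that by (auto simp: simple_integrand_def space_F)
    then obtain C where C: "\<bar>\<xi> i \<omega>\<bar> \<le> C" if "\<omega> \<in> space M" for \<omega>
      by (auto simp: bounded_iff)
    have "\<xi> i \<in> borel_measurable M"
      using S that measurable_F_M by (auto simp: simple_integrand_def)
    then show ?thesis
      using C by (intro integrable_const_bound[where B="C\<^sup>2"] AE_I2) (auto simp: abs_le_square_iff[symmetric] intro: order_trans[OF _ abs_ge_self])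
  qed
  have le: "\<tau> i \<le> \<tau> (Suc i)" if "i < n" for i
    using S that by (simp add: simple_integrand_def)
  note mom = elementary_integral_moments[OF S a order_refl]
  have "(\<integral>\<^sup>+ \<omega>. ennreal ((elementary_integral W n \<tau> \<xi> \<omega>)\<^sup>2) \<partial>M)
      = ennreal (\<Sum>i<n. (\<tau> (Suc i) - \<tau> i) * expectation (\<lambda>\<omega>. (\<xi> i \<omega>)\<^sup>2))"
    using mom by (subst nn_integral_eq_integral) auto
  also have "\<dots> = ennreal (expectation (\<lambda>\<omega>. \<Sum>i<n. (\<tau> (Suc i) - \<tau> i) * (\<xi> i \<omega>)\<^sup>2))"
    using xi2 by (subst Bochner_Integration.integral_sum) auto
  also have "\<dots> = (\<integral>\<^sup>+ \<omega>. ennreal (\<Sum>i<n. (\<tau> (Suc i) - \<tau> i) * (\<xi> i \<omega>)\<^sup>2) \<partial>M)"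
    using xi2 le by (intro nn_integral_eq_integral[symmetric] Bochner_Integration.integrable_sum AE_I2 sum_nonneg) auto
  finally show ?thesis
    by (simp add: nn_integral_step_fun_square[OF S])
qed

end

section \<open>From simple integrands to mean-square limits\<close>

lemma nn_integral_square_triangle:
  fixes f g :: "'a \<Rightarrow> real"
  assumes [measurable]: "f \<in> borel_measurable N" "g \<in> borel_measurable N"
  shows "(\<integral>\<^sup>+ x. ennreal ((f x)\<^sup>2) \<partial>N)
    \<le> 2 * (\<integral>\<^sup>+ x. ennreal ((f x - g x)\<^sup>2) \<partial>N) + 2 * (\<integral>\<^sup>+ x. ennreal ((g x)\<^sup>2) \<partial>N)"
proof -
  \<comment> \<open>Right side minus left side is the square of f x - 2 * g x.\<close>
  have "(f x)\<^sup>2 \<le> 2 * (f x - g x)\<^sup>2 + 2 * (g x)\<^sup>2" for x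
    using zero_le_power2[of "f x - 2 * g x"] by (simp add: power2_eq_square algebra_simps)
  then have "ennreal ((f x)\<^sup>2) \<le> 2 * ennreal ((f x - g x)\<^sup>2) + 2 * ennreal ((g x)\<^sup>2)" for x
    by (simp flip: ennreal_numeral ennreal_mult' ennreal_plus)
  then have "(\<integral>\<^sup>+ x. ennreal ((f x)\<^sup>2) \<partial>N)
      \<le> (\<integral>\<^sup>+ x. 2 * ennreal ((f x - g x)\<^sup>2) + 2 * ennreal ((g x)\<^sup>2) \<partial>N)"
    by (intro nn_integral_mono)
  also have "\<dots> = 2 * (\<integral>\<^sup>+ x. ennreal ((f x - g x)\<^sup>2) \<partial>N) + 2 * (\<integral>\<^sup>+ x. ennreal ((g x)\<^sup>2) \<partial>N)"
    by (simp add: nn_integral_add nn_integral_cmult)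
  finally show ?thesis .
qed

lemma tendsto_zero_ennreal_bound:
  fixes f g :: "'b \<Rightarrow> ennreal"
  assumes "(f \<longlongrightarrow> 0) G" "\<And>x. g x \<le> ennreal c * f x"
  shows "(g \<longlongrightarrow> 0) G"
proof (rule tendsto_sandwich[of "\<lambda>_. 0" g G "\<lambda>x. ennreal c * f x"])
  show "((\<lambda>x. ennreal c * f x) \<longlongrightarrow> 0) G"
    using ennreal_tendsto_cmult[OF ennreal_less_top assms(1), of c] by simp
qed (use assms(2) in auto)

lemma nn_integral_square_linear:
  fixes \<ll> :: "'a::euclidean_space \<Rightarrow> 'b::euclidean_space"
  assumes "\<And>x. norm (\<ll> x) \<le> norm x * K" and [measurable]: "f \<in> borel_measurable N"
  shows "(\<integral>\<^sup>+ x. ennreal ((norm (\<ll> (f x)))\<^sup>2) \<partial>N) \<le> ennreal (K\<^sup>2) * (\<integral>\<^sup>+ x. ennreal ((norm (f x))\<^sup>2) \<partial>N)"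
proof -
  have "ennreal ((norm (\<ll> x))\<^sup>2) \<le> ennreal (K\<^sup>2) * ennreal ((norm x)\<^sup>2)" for x
    using power_mono[OF assms(1)[of x] norm_ge_zero, of 2]
    by (simp add: ennreal_mult'[symmetric] power_mult_distrib mult.commute)
  then have "(\<integral>\<^sup>+ x. ennreal ((norm (\<ll> (f x)))\<^sup>2) \<partial>N) \<le> (\<integral>\<^sup>+ x. ennreal (K\<^sup>2) * ennreal ((norm (f x))\<^sup>2) \<partial>N)"
    by (intro nn_integral_mono)
  also have "\<dots> = ennreal (K\<^sup>2) * (\<integral>\<^sup>+ x. ennreal ((norm (f x))\<^sup>2) \<partial>N)"
    by (rule nn_integral_cmult) measurable
  finally show ?thesis .
qed

lemma sigma_finite_restrict_lborel: "sigma_finite_measure (restrict_space lborel {a..b::real})"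
  by (rule sigma_finite_measure_restrict_space) (auto intro: lborel.sigma_finite_measure_axioms)

text \<open>As one integral over a product measure, the time-noise norm obeys the same square
  estimates as the norm of a random variable.\<close>

lemma iterated_nn_integral:
  fixes a b :: real
  assumes "(\<lambda>(\<omega>, s). f s \<omega>) \<in> borel_measurable (M \<Otimes>\<^sub>M restrict_space lborel {a..b})"
  shows "(\<integral>\<^sup>+ \<omega>. (\<integral>\<^sup>+ s\<in>{a..b}. f s \<omega> \<partial>lborel) \<partial>M)
    = (\<integral>\<^sup>+ (\<omega>, s). f s \<omega> \<partial>(M \<Otimes>\<^sub>M restrict_space lborel {a..b}))"
  using sigma_finite_measure.nn_integral_fst[OF sigma_finite_restrict_lborel assms]
  by (simp add: nn_integral_restrict_space)

text \<open>Ito integrands are jointly measurable with time first, whereas the norms integrate over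
  time inside and over noise outside.\<close>

lemma measurable_restrict_swap:
  assumes "(\<lambda>(s, \<omega>). X s \<omega>) \<in> borel_measurable (restrict_space borel {a..b::real} \<Otimes>\<^sub>M M)"
  shows "(\<lambda>(\<omega>, s). X s \<omega>) \<in> borel_measurable (M \<Otimes>\<^sub>M restrict_space lborel {a..b})"
proof -
  have sets_eq: "sets (M \<Otimes>\<^sub>M restrict_space lborel {a..b}) = sets (M \<Otimes>\<^sub>M restrict_space borel {a..b})"
    by (intro sets_pair_measure_cong sets_restrict_space_cong) auto
  show ?thesis
    using measurable_pair_swap[OF assms] by (simp add: measurable_cong_sets[OF sets_eq refl] split_beta')
qed

lemma (in wiener) step_fun_measurable:
  fixes \<xi> :: "nat \<Rightarrow> 'w \<Rightarrow> 'a::euclidean_space"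
  assumes "simple_integrand F a b n \<tau> \<xi>"
  shows "(\<lambda>(\<omega>, s). step_fun n \<tau> \<xi> s \<omega>) \<in> borel_measurable (M \<Otimes>\<^sub>M restrict_space lborel {a..b})"
proof -
  have \<xi>: "\<xi> i \<in> borel_measurable M" if "i < n" for i
    using assms that measurable_F_M by (auto simp: simple_integrand_def)
  have id: "(\<lambda>s. s) \<in> measurable (restrict_space lborel {a..b}) borel"
    by (intro measurable_restrict_space1) simp
  have "(\<lambda>x. indicator {\<tau> i <.. \<tau> (Suc i)} (snd x) *\<^sub>R \<xi> i (fst x))
      \<in> borel_measurable (M \<Otimes>\<^sub>M restrict_space lborel {a..b})" if "i < n" for i
  proof (intro borel_measurable_scaleR)
    show "(\<lambda>x. \<xi> i (fst x)) \<in> borel_measurable (M \<Otimes>\<^sub>M restrict_space lborel {a..b})"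
      using \<xi>[OF that] by measurable
    have "snd \<in> measurable (M \<Otimes>\<^sub>M restrict_space lborel {a..b}) borel"
      using measurable_compose[OF measurable_snd id] .
    then show "(\<lambda>x. indicator {\<tau> i <.. \<tau> (Suc i)} (snd x) :: real) \<in> borel_measurable (M \<Otimes>\<^sub>M restrict_space lborel {a..b})"
      by measurable
  qed
  then show ?thesis
    unfolding step_fun_def split_beta' by (intro borel_measurable_sum) simp
qed

lemma (in wiener) elementary_integral_measurable:
  fixes \<xi> :: "nat \<Rightarrow> 'w \<Rightarrow> 'a::euclidean_space"
  assumes S: "simple_integrand F a b n \<tau> \<xi>" and a: "0 \<le> a"
  shows "elementary_integral W n \<tau> \<xi> \<in> borel_measurable M"
proof -
  have "(\<lambda>\<omega>. (W (\<tau> (Suc i)) \<omega> - W (\<tau> i) \<omega>) *\<^sub>R \<xi> i \<omega>) \<in> borel_measurable M" if "i < n" for i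
  proof -
    have "W (\<tau> i) \<in> borel_measurable M" "W (\<tau> (Suc i)) \<in> borel_measurable M"
      using simple_integrand_bounds[OF S, of i] simple_integrand_bounds[OF S, of "Suc i"] that a
      by (auto intro!: measurable_F_M W_measurable_F)
    moreover have "\<xi> i \<in> borel_measurable M"
      using S that measurable_F_M by (auto simp: simple_integrand_def)
    ultimately show ?thesis by measurable
  qed
  then show ?thesis
    by (simp add: elementary_integral_def[abs_def] borel_measurable_sum)
qed

context wiener
begin

text \<open>The images of the approximating simple integrands approximate the image, with squared
  errors enlarged at most by the square of the operator bound. This reduces the matrix-valued
  equation to real-valued integrals.\<close>

lemma has_ito_integral_linear:
  fixes \<ll> :: "'a::euclidean_space \<Rightarrow> 'b::euclidean_space"
  assumes lin: "bounded_linear \<ll>" and a: "0 \<le> a" and X: "has_ito_integral M F W a b X I"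
  shows "has_ito_integral M F W a b (\<lambda>s \<omega>. \<ll> (X s \<omega>)) (\<lambda>\<omega>. \<ll> (I \<omega>))"
proof -
  interpret bounded_linear \<ll> by fact
  let ?N = "M \<Otimes>\<^sub>M restrict_space lborel {a..b}"
  obtain K where K: "\<And>x. norm (\<ll> x) \<le> norm x * K"
    using nonneg_bounded by blast
  have \<ll>m[measurable]: "\<ll> \<in> borel_measurable borel"
    by (intro borel_measurable_continuous_onI linear_continuous_on lin)
  have X1: "(\<lambda>(s, \<omega>). X s \<omega>) \<in> borel_measurable (restrict_space borel {a..b} \<Otimes>\<^sub>M M)"
    and X2: "\<And>s. s \<in> {a..b} \<Longrightarrow> X s \<in> borel_measurable (F s)"
    and X3: "(\<integral>\<^sup>+ \<omega>. (\<integral>\<^sup>+ s\<in>{a..b}. ennreal ((norm (X s \<omega>))\<^sup>2) \<partial>lborel) \<partial>M) < \<infinity>"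
    and I: "I \<in> borel_measurable M"
    using X by (auto simp: has_ito_integral_def)
  note XN = measurable_restrict_swap[OF X1]
  obtain n \<tau> \<xi> where S: "\<And>m. simple_integrand F a b (n m) (\<tau> m) (\<xi> m)"
    and L1: "(\<lambda>m. \<integral>\<^sup>+ \<omega>. (\<integral>\<^sup>+ s\<in>{a..b}.
            ennreal ((norm (X s \<omega> - step_fun (n m) (\<tau> m) (\<xi> m) s \<omega>))\<^sup>2) \<partial>lborel) \<partial>M) \<longlonglongrightarrow> 0"
    and L2: "(\<lambda>m. \<integral>\<^sup>+ \<omega>. ennreal ((norm (I \<omega> - elementary_integral W (n m) (\<tau> m) (\<xi> m) \<omega>))\<^sup>2) \<partial>M) \<longlonglongrightarrow> 0"
    using X unfolding has_ito_integral_def by blast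
  define \<xi>' where "\<xi>' = (\<lambda>m i \<omega>. \<ll> (\<xi> m i \<omega>))"
  have S': "simple_integrand F a b (n m) (\<tau> m) (\<xi>' m)" for m
  proof -
    have "bounded (\<xi>' m i ` space (F (\<tau> m i)))" if "i < n m" for i
      using bounded_linear_image[OF _ lin, of "\<xi> m i ` space (F (\<tau> m i))"] S[of m] that
      by (simp add: \<xi>'_def image_image simple_integrand_def)
    moreover have "\<xi>' m i \<in> borel_measurable (F (\<tau> m i))" if "i < n m" for i
      unfolding \<xi>'_def using S[of m] that by (intro measurable_compose[OF _ \<ll>m]) (simp add: simple_integrand_def)
    ultimately show ?thesis
      using S[of m] by (simp add: simple_integrand_def)
  qed
  have step: "step_fun (n m) (\<tau> m) (\<xi>' m) s \<omega> = \<ll> (step_fun (n m) (\<tau> m) (\<xi> m) s \<omega>)" for m s \<omega>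
    by (simp add: step_fun_def \<xi>'_def sum scaleR)
  have elem: "elementary_integral W (n m) (\<tau> m) (\<xi>' m) \<omega> = \<ll> (elementary_integral W (n m) (\<tau> m) (\<xi> m) \<omega>)" for m \<omega>
    by (simp add: elementary_integral_def \<xi>'_def sum scaleR)
  \<comment> \<open>Stated for a general \<open>f\<close>: it serves for the integrand itself and
    for the approximation errors.\<close>
  have le: "(\<integral>\<^sup>+ \<omega>. (\<integral>\<^sup>+ s\<in>{a..b}. ennreal ((norm (\<ll> (f s \<omega>)))\<^sup>2) \<partial>lborel) \<partial>M)
      \<le> ennreal (K\<^sup>2) * (\<integral>\<^sup>+ \<omega>. (\<integral>\<^sup>+ s\<in>{a..b}. ennreal ((norm (f s \<omega>))\<^sup>2) \<partial>lborel) \<partial>M)"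
    if f: "(\<lambda>(\<omega>, s). f s \<omega>) \<in> borel_measurable ?N" for f :: "real \<Rightarrow> 'w \<Rightarrow> 'a"
  proof -
    have f': "(\<lambda>z. f (snd z) (fst z)) \<in> borel_measurable ?N"
      using f by (simp add: split_beta')
    then have "(\<lambda>z. ennreal ((norm (f (snd z) (fst z)))\<^sup>2)) \<in> borel_measurable ?N"
      "(\<lambda>z. ennreal ((norm (\<ll> (f (snd z) (fst z))))\<^sup>2)) \<in> borel_measurable ?N"
      by measurable
    then show ?thesis
      using nn_integral_square_linear[OF K f'] by (subst (1 2) iterated_nn_integral) (simp_all add: split_beta')
  qed
  show ?thesis
    unfolding has_ito_integral_def
  proof (intro conjI ballI exI[of _ n] exI[of _ \<tau>] exI[of _ \<xi>'] allI)
    show "(\<lambda>(s, \<omega>). \<ll> (X s \<omega>)) \<in> borel_measurable (restrict_space borel {a..b} \<Otimes>\<^sub>M M)"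
      using measurable_compose[OF X1 \<ll>m] by (simp add: split_beta')
    show "(\<lambda>\<omega>. \<ll> (X s \<omega>)) \<in> borel_measurable (F s)" if "s \<in> {a..b}" for s
      using measurable_compose[OF X2[OF that] \<ll>m] .
    show "(\<integral>\<^sup>+ \<omega>. (\<integral>\<^sup>+ s\<in>{a..b}. ennreal ((norm (\<ll> (X s \<omega>)))\<^sup>2) \<partial>lborel) \<partial>M) < \<infinity>"
      using le[OF XN] X3 by (auto intro: le_less_trans simp: ennreal_mult_less_top)
    show "(\<lambda>\<omega>. \<ll> (I \<omega>)) \<in> borel_measurable M"
      using measurable_compose[OF I \<ll>m] .
    show "(\<lambda>m. \<integral>\<^sup>+ \<omega>. (\<integral>\<^sup>+ s\<in>{a..b}.
        ennreal ((norm (\<ll> (X s \<omega>) - step_fun (n m) (\<tau> m) (\<xi>' m) s \<omega>))\<^sup>2) \<partial>lborel) \<partial>M) \<longlonglongrightarrow> 0"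
    proof (rule tendsto_zero_ennreal_bound[OF L1, where c = "K\<^sup>2"])
      fix m
      have "(\<lambda>(\<omega>, s). X s \<omega> - step_fun (n m) (\<tau> m) (\<xi> m) s \<omega>) \<in> borel_measurable ?N"
        using borel_measurable_diff[OF XN step_fun_measurable[OF S]] by (simp add: split_beta')
      from le[OF this] show "(\<integral>\<^sup>+ \<omega>. (\<integral>\<^sup>+ s\<in>{a..b}.
        ennreal ((norm (\<ll> (X s \<omega>) - step_fun (n m) (\<tau> m) (\<xi>' m) s \<omega>))\<^sup>2) \<partial>lborel) \<partial>M)
        \<le> ennreal (K\<^sup>2) * (\<integral>\<^sup>+ \<omega>. (\<integral>\<^sup>+ s\<in>{a..b}.
            ennreal ((norm (X s \<omega> - step_fun (n m) (\<tau> m) (\<xi> m) s \<omega>))\<^sup>2) \<partial>lborel) \<partial>M)"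
        by (simp only: step diff)
    qed
    show "(\<lambda>m. \<integral>\<^sup>+ \<omega>. ennreal ((norm (\<ll> (I \<omega>) - elementary_integral W (n m) (\<tau> m) (\<xi>' m) \<omega>))\<^sup>2) \<partial>M) \<longlonglongrightarrow> 0"
    proof (rule tendsto_zero_ennreal_bound[OF L2, where c = "K\<^sup>2"])
      fix m
      have "(\<lambda>\<omega>. I \<omega> - elementary_integral W (n m) (\<tau> m) (\<xi> m) \<omega>) \<in> borel_measurable M"
        using borel_measurable_diff[OF I elementary_integral_measurable[OF S a]] .
      from nn_integral_square_linear[OF K this]
      show "(\<integral>\<^sup>+ \<omega>. ennreal ((norm (\<ll> (I \<omega>) - elementary_integral W (n m) (\<tau> m) (\<xi>' m) \<omega>))\<^sup>2) \<partial>M)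
        \<le> ennreal (K\<^sup>2) * (\<integral>\<^sup>+ \<omega>. ennreal ((norm (I \<omega> - elementary_integral W (n m) (\<tau> m) (\<xi> m) \<omega>))\<^sup>2) \<partial>M)"
        by (simp only: elem diff)
    qed
  qed (use S' in auto)
qed

text \<open>Only boundedness of second moments matters below, so the Ito isometry is kept in the form of two
  inequalities: the factor 4 comes from applying \<open>x\<^sup>2 \<le> 2 * (x - y)\<^sup>2 + 2 * y\<^sup>2\<close> twice.\<close>

lemma
  fixes X :: "real \<Rightarrow> 'w \<Rightarrow> real"
  assumes X: "has_ito_integral M F W a b X I" and a: "0 \<le> a"
  shows ito_integral_square_le: "(\<integral>\<^sup>+ \<omega>. ennreal ((I \<omega>)\<^sup>2) \<partial>M)
      \<le> 4 * (\<integral>\<^sup>+ \<omega>. (\<integral>\<^sup>+ s\<in>{a..b}. ennreal ((X s \<omega>)\<^sup>2) \<partial>lborel) \<partial>M)"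
    and ito_integrand_square_le: "(\<integral>\<^sup>+ \<omega>. (\<integral>\<^sup>+ s\<in>{a..b}. ennreal ((X s \<omega>)\<^sup>2) \<partial>lborel) \<partial>M)
      \<le> 4 * (\<integral>\<^sup>+ \<omega>. ennreal ((I \<omega>)\<^sup>2) \<partial>M)"
    and ito_integral_integrable: "integrable M I"
    and ito_integral_expectation: "expectation I = 0"
proof -
  let ?N = "M \<Otimes>\<^sub>M restrict_space lborel {a..b}"
  have X1: "(\<lambda>(s, \<omega>). X s \<omega>) \<in> borel_measurable (restrict_space borel {a..b} \<Otimes>\<^sub>M M)"
    and X3: "(\<integral>\<^sup>+ \<omega>. (\<integral>\<^sup>+ s\<in>{a..b}. ennreal ((X s \<omega>)\<^sup>2) \<partial>lborel) \<partial>M) < \<infinity>"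
    and I[measurable]: "I \<in> borel_measurable M"
    using X by (auto simp: has_ito_integral_def)
  have XN: "(\<lambda>z. X (snd z) (fst z)) \<in> borel_measurable ?N"
    using measurable_restrict_swap[OF X1] by (simp add: split_beta')
  obtain n \<tau> \<xi> where S: "\<And>m. simple_integrand F a b (n m) (\<tau> m) (\<xi> m)"
    and L1: "(\<lambda>m. \<integral>\<^sup>+ \<omega>. (\<integral>\<^sup>+ s\<in>{a..b}.
            ennreal ((X s \<omega> - step_fun (n m) (\<tau> m) (\<xi> m) s \<omega>)\<^sup>2) \<partial>lborel) \<partial>M) \<longlonglongrightarrow> 0"
    and L2: "(\<lambda>m. \<integral>\<^sup>+ \<omega>. ennreal ((I \<omega> - elementary_integral W (n m) (\<tau> m) (\<xi> m) \<omega>)\<^sup>2) \<partial>M) \<longlonglongrightarrow> 0"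
    using X unfolding has_ito_integral_def by (simp only: real_norm_def power2_abs) blast
  define Y where "Y m s \<omega> = step_fun (n m) (\<tau> m) (\<xi> m) s \<omega>" for m s \<omega>
  define E where "E m \<omega> = elementary_integral W (n m) (\<tau> m) (\<xi> m) \<omega>" for m \<omega>
  have YN: "(\<lambda>z. Y m (snd z) (fst z)) \<in> borel_measurable ?N" for m
    using step_fun_measurable[OF S, of m] by (simp add: split_beta' Y_def)
  have E[measurable]: "E m \<in> borel_measurable M" for m
    using elementary_integral_measurable[OF S a, of m] by (simp add: E_def[abs_def])
  define dX where "dX m = (\<integral>\<^sup>+ \<omega>. (\<integral>\<^sup>+ s\<in>{a..b}. ennreal ((X s \<omega> - Y m s \<omega>)\<^sup>2) \<partial>lborel) \<partial>M)" for m
  define dI where "dI m = (\<integral>\<^sup>+ \<omega>. ennreal ((I \<omega> - E m \<omega>)\<^sup>2) \<partial>M)" for m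
  define nX where "nX = (\<integral>\<^sup>+ \<omega>. (\<integral>\<^sup>+ s\<in>{a..b}. ennreal ((X s \<omega>)\<^sup>2) \<partial>lborel) \<partial>M)"
  define nI where "nI = (\<integral>\<^sup>+ \<omega>. ennreal ((I \<omega>)\<^sup>2) \<partial>M)"
  define nY where "nY m = (\<integral>\<^sup>+ \<omega>. (\<integral>\<^sup>+ s\<in>{a..b}. ennreal ((Y m s \<omega>)\<^sup>2) \<partial>lborel) \<partial>M)" for m
  have nE: "(\<integral>\<^sup>+ \<omega>. ennreal ((E m \<omega>)\<^sup>2) \<partial>M) = nY m" for m
    unfolding nY_def Y_def E_def using elementary_integral_isometry[OF S a] .
  \<comment> \<open>The error is listed with both signs, because the triangle estimate is applied
    from \<open>X\<close> to \<open>Y m\<close> and back.\<close>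
  have swap: "nX = (\<integral>\<^sup>+ z. ennreal ((X (snd z) (fst z))\<^sup>2) \<partial>?N)"
    "nY m = (\<integral>\<^sup>+ z. ennreal ((Y m (snd z) (fst z))\<^sup>2) \<partial>?N)"
    "dX m = (\<integral>\<^sup>+ z. ennreal ((X (snd z) (fst z) - Y m (snd z) (fst z))\<^sup>2) \<partial>?N)"
    "dX m = (\<integral>\<^sup>+ z. ennreal ((Y m (snd z) (fst z) - X (snd z) (fst z))\<^sup>2) \<partial>?N)" for m
  proof -
    show "nX = (\<integral>\<^sup>+ z. ennreal ((X (snd z) (fst z))\<^sup>2) \<partial>?N)"
      unfolding nX_def using XN by (subst iterated_nn_integral) (auto simp: split_beta')
    show "nY m = (\<integral>\<^sup>+ z. ennreal ((Y m (snd z) (fst z))\<^sup>2) \<partial>?N)"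
      unfolding nY_def using YN[of m] by (subst iterated_nn_integral) (auto simp: split_beta')
    show d: "dX m = (\<integral>\<^sup>+ z. ennreal ((X (snd z) (fst z) - Y m (snd z) (fst z))\<^sup>2) \<partial>?N)"
      unfolding dX_def using XN YN[of m] by (subst iterated_nn_integral) (auto simp: split_beta')
    show "dX m = (\<integral>\<^sup>+ z. ennreal ((Y m (snd z) (fst z) - X (snd z) (fst z))\<^sup>2) \<partial>?N)"
      unfolding d by (simp add: power2_commute)
  qed
  have dI': "dI m = (\<integral>\<^sup>+ \<omega>. ennreal ((E m \<omega> - I \<omega>)\<^sup>2) \<partial>M)" for m
    unfolding dI_def by (simp add: power2_commute)
  \<comment> \<open>The bound produced by two triangle estimates joined by the isometry; both
    inequalities arise from it by exchanging the two errors.\<close>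
  have lim: "(\<lambda>m. 2 * c m + 2 * (2 * d m + 2 * e)) \<longlonglongrightarrow> 4 * e" if "c \<longlonglongrightarrow> 0" "d \<longlonglongrightarrow> 0" for c d and e :: ennreal
  proof -
    have "(\<lambda>m. 2 * c m + 2 * (2 * d m + 2 * e)) \<longlonglongrightarrow> 2 * 0 + 2 * (2 * 0 + 2 * e)"
      using that by (intro tendsto_add ennreal_tendsto_cmult tendsto_const) auto
    then show ?thesis by (simp add: mult.assoc[symmetric])
  qed
  have lims: "dX \<longlonglongrightarrow> 0" "dI \<longlonglongrightarrow> 0"
    using L1 L2 by (simp_all add: dX_def[abs_def] dI_def[abs_def] Y_def E_def)
  have "nX \<le> 2 * dX m + 2 * (2 * dI m + 2 * nI)" for m
  proof -
    have "nX \<le> 2 * dX m + 2 * nY m"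
      unfolding swap(1) swap(2,3)[of m] using nn_integral_square_triangle[OF XN YN[of m]] by simp
    moreover have "nY m \<le> 2 * dI m + 2 * nI"
      unfolding nE[symmetric] dI' nI_def by (rule nn_integral_square_triangle) auto
    ultimately show ?thesis
      by (meson add_left_mono mult_left_mono order_trans zero_le)
  qed
  then have leX: "nX \<le> 4 * nI"
    by (intro LIMSEQ_le_const[OF lim[OF lims]]) auto
  have "nI \<le> 2 * dI m + 2 * (2 * dX m + 2 * nX)" for m
  proof -
    have "nI \<le> 2 * dI m + 2 * nY m"
      unfolding nE[symmetric] dI_def nI_def by (rule nn_integral_square_triangle) auto
    moreover have "nY m \<le> 2 * dX m + 2 * nX"
      unfolding swap(1) swap(2,4)[of m] using nn_integral_square_triangle[OF YN[of m] XN] by simp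
    ultimately show ?thesis
      by (meson add_left_mono mult_left_mono order_trans zero_le)
  qed
  then have leI: "nI \<le> 4 * nX"
    by (intro LIMSEQ_le_const[OF lim[OF lims(2,1)]]) auto
  show "nI \<le> 4 * nX" "nX \<le> 4 * nI" by fact+
  have "nI < \<infinity>"
    using leI X3 by (auto simp: nX_def[symmetric] ennreal_mult_less_top intro: le_less_trans)
  then have I2: "integrable M (\<lambda>\<omega>. (I \<omega>)\<^sup>2)"
    unfolding nI_def by (intro integrableI_nonneg) auto
  from I2 show I1: "integrable M I"
    by (rule square_integrable_imp_integrable[rotated]) simp
  show "expectation I = 0"
  proof -
    \<comment> \<open>Elementary integrals have mean zero, so the mean of \<open>I\<close> is that
      of the error, and a squared mean is at most the second moment.\<close>
    have le: "ennreal ((expectation I)\<^sup>2) \<le> dI m" for m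
    proof -
      note mom = elementary_integral_moments[OF S a order_refl, of m]
      have Em: "integrable M (E m)" "expectation (E m) = 0" "integrable M (\<lambda>\<omega>. (E m \<omega>)\<^sup>2)"
        using mom by (simp_all add: E_def[abs_def])
      have int: "integrable M (\<lambda>\<omega>. I \<omega> - E m \<omega>)"
        using I1 Em by simp
      have int2: "integrable M (\<lambda>\<omega>. (I \<omega> - E m \<omega>)\<^sup>2)"
      proof (rule Bochner_Integration.integrable_bound)
        show "integrable M (\<lambda>\<omega>. 2 * (I \<omega>)\<^sup>2 + 2 * (E m \<omega>)\<^sup>2)"
          using I2 Em by simp
        have "(x - y)\<^sup>2 \<le> 2 * x\<^sup>2 + 2 * y\<^sup>2" for x y :: real
          using zero_le_power2[of "x + y"] by (simp add: power2_eq_square algebra_simps)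
        then show "AE \<omega> in M. norm ((I \<omega> - E m \<omega>)\<^sup>2) \<le> norm (2 * (I \<omega>)\<^sup>2 + 2 * (E m \<omega>)\<^sup>2)"
          by (intro AE_I2) (auto intro: order_trans[OF _ abs_ge_self])
      qed measurable
      have "(expectation I)\<^sup>2 = (expectation (\<lambda>\<omega>. I \<omega> - E m \<omega>))\<^sup>2"
        using I1 Em by simp
      also have "\<dots> \<le> expectation (\<lambda>\<omega>. (I \<omega> - E m \<omega>)\<^sup>2)"
        using variance_eq[OF int int2] variance_positive[of "\<lambda>\<omega>. I \<omega> - E m \<omega>"] by simp
      finally have "ennreal ((expectation I)\<^sup>2) \<le> ennreal (expectation (\<lambda>\<omega>. (I \<omega> - E m \<omega>)\<^sup>2))"
        by (rule ennreal_leI)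
      also have "\<dots> = dI m"
        unfolding dI_def using int2 by (subst nn_integral_eq_integral) auto
      finally show ?thesis .
    qed
    have "ennreal ((expectation I)\<^sup>2) \<le> 0"
      using le by (intro LIMSEQ_le_const[OF lims(2)]) auto
    then show ?thesis by simp
  qed
qed

end


section \<open>Long-time behaviour of the measured populations\<close>

text \<open>A function measurable in the noise and continuous in time is a pointwise limit of its
  values on finer and finer time grids. Rounding up keeps the grid times at or after
  \<open>t\<close>, where the hypotheses hold.\<close>

lemma (in wiener) continuous_process_measurable:
  fixes X :: "real \<Rightarrow> 'w \<Rightarrow> real"
  assumes meas: "\<And>s. t \<le> s \<Longrightarrow> X s \<in> borel_measurable M"
    and cont: "\<And>\<omega>. \<omega> \<in> space M \<Longrightarrow> continuous_on {t..} (\<lambda>s. X s \<omega>)"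
  shows "(\<lambda>(\<omega>, s). X s \<omega>) \<in> borel_measurable (M \<Otimes>\<^sub>M restrict_space lborel {t..b})"
proof -
  let ?N = "M \<Otimes>\<^sub>M restrict_space lborel {t..b}"
  have id: "(\<lambda>s. s) \<in> measurable (restrict_space lborel {t..b}) borel"
    by (intro measurable_restrict_space1) simp
  have [measurable]: "snd \<in> measurable ?N borel"
    using measurable_compose[OF measurable_snd id] .
  \<comment> \<open>\<open>g i s\<close> is \<open>s\<close> rounded up to the grid \<open>t + k / (i + 1)\<close>\<close>
  define g where "g i s = t + real (nat \<lceil>(s - t) * real (Suc i)\<rceil>) / real (Suc i)" for i s
  show ?thesis
  proof (rule borel_measurable_LIMSEQ_real[where u="\<lambda>i z. X (g i (snd z)) (fst z)"])
    fix i
    \<comment> \<open>For fixed \<open>i\<close> only countably many random variables occur,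
      selected by a measurable index.\<close>
    have "(\<lambda>z. X (t + real k / real (Suc i)) (fst z)) \<in> borel_measurable ?N" for k
      using meas[of "t + real k / real (Suc i)"] by measurable
    moreover have "(\<lambda>z. nat \<lceil>(snd z - t) * real (Suc i)\<rceil>) \<in> measurable ?N (count_space UNIV)"
      by measurable
    ultimately show "(\<lambda>z. X (g i (snd z)) (fst z)) \<in> borel_measurable ?N"
      unfolding g_def by (rule measurable_compose_countable)
  next
    fix z assume z: "z \<in> space ?N"
    obtain \<omega> s where z': "z = (\<omega>, s)" by (cases z)
    have \<omega>: "\<omega> \<in> space M" and s: "t \<le> s"
      using z by (auto simp: z' space_pair_measure space_restrict_space)
    have g1: "s \<le> g i s" "g i s \<le> s + 1 / real (Suc i)" for i
    proof -
      have nn: "0 \<le> (s - t) * real (Suc i)" using s by simp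
      then have "real (nat \<lceil>(s - t) * real (Suc i)\<rceil>) = of_int \<lceil>(s - t) * real (Suc i)\<rceil>"
        by (simp add: order_trans[OF _ le_of_int_ceiling])
      then have 1: "(s - t) * real (Suc i) \<le> real (nat \<lceil>(s - t) * real (Suc i)\<rceil>)"
        "real (nat \<lceil>(s - t) * real (Suc i)\<rceil>) \<le> (s - t) * real (Suc i) + 1"
        by linarith+
      show "s \<le> g i s" "g i s \<le> s + 1 / real (Suc i)"
        using divide_right_mono[OF 1(1), of "real (Suc i)"] divide_right_mono[OF 1(2), of "real (Suc i)"]
        unfolding g_def by (simp_all add: add_divide_distrib)
    qed
    have "(\<lambda>i. g i s) \<longlonglongrightarrow> s"
    proof (rule tendsto_sandwich[of "\<lambda>_. s" _ _ "\<lambda>i. s + 1 / real (Suc i)"])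
      show "(\<lambda>i. s + 1 / real (Suc i)) \<longlonglongrightarrow> s"
        using tendsto_add[OF tendsto_const[of s] LIMSEQ_inverse_real_of_nat] by (simp add: inverse_eq_divide)
    qed (use g1 in auto)
    then have "(\<lambda>i. X (g i s) \<omega>) \<longlonglongrightarrow> X s \<omega>"
      using g1(1) s by (intro continuous_on_tendsto_compose[OF cont[OF \<omega>]]) (auto intro!: always_eventually order_trans[OF s])
    then show "(\<lambda>i. X (g i (snd z)) (fst z)) \<longlonglongrightarrow> (case z of (\<omega>, s) \<Rightarrow> X s \<omega>)"
      by (simp add: z')
  qed
qed

text \<open>The cost integrates over the completed measure, the product measure used for exchanging
  integrals is built on the Borel one; for a Borel integrand they agree.\<close>

lemma integral_lebesgue_on_eq_lborel:
  fixes f :: "real \<Rightarrow> real"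
  assumes "f \<in> borel_measurable (restrict_space lborel {a..b})"
  shows "integral\<^sup>L (lebesgue_on {a..b}) f = integral\<^sup>L (restrict_space lborel {a..b}) f"
proof -
  have "(\<lambda>x. indicator {a..b} x *\<^sub>R f x) \<in> borel_measurable lborel"
    using assms by (subst (asm) borel_measurable_restrict_space_iff) auto
  then show ?thesis
    by (simp add: integral_restrict_space integral_completion)
qed

text \<open>Meant for time averages, where T * f T is an accumulated cost over an interval of length
  T - t. The constant K may depend on \<epsilon>, since dividing by T removes it.\<close>

lemma tendsto_of_linear_growth:
  fixes f :: "real \<Rightarrow> real"
  assumes "\<And>\<epsilon>. 0 < \<epsilon> \<Longrightarrow> \<exists>K. \<forall>T\<ge>t0. \<bar>T * f T - c * (T - t)\<bar> \<le> \<epsilon> * (T - t) + K" and "0 \<le> t"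
  shows "(f \<longlongrightarrow> c) at_top"
proof (rule tendstoI)
  fix e :: real assume e: "0 < e"
  obtain K where K: "\<And>T. t0 \<le> T \<Longrightarrow> \<bar>T * f T - c * (T - t)\<bar> \<le> e / 2 * (T - t) + K"
    using assms(1)[of "e / 2"] e by auto
  \<comment> \<open>Collects all that does not grow with T: the constant K and the cost of replacing
    T - t by T.\<close>
  define B where "B = \<bar>K\<bar> + \<bar>c\<bar> * t"
  have "\<forall>\<^sub>F T in at_top. t0 \<le> T \<and> 0 < T \<and> 2 * B / e < T"
    by (intro eventually_conj eventually_ge_at_top eventually_gt_at_top)
  then show "\<forall>\<^sub>F T in at_top. dist (f T) c < e"
  proof eventually_elim
    case (elim T)
    have "T * \<bar>f T - c\<bar> = \<bar>T * (f T - c)\<bar>"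
      using elim by (simp add: abs_mult)
    also have "\<dots> = \<bar>T * f T - c * T\<bar>"
      by (simp add: algebra_simps)
    also have "\<dots> \<le> \<bar>T * f T - c * (T - t)\<bar> + \<bar>c\<bar> * t"
      using assms(2) abs_triangle_ineq[of "T * f T - c * (T - t)" "- (c * t)"]
      by (simp add: algebra_simps abs_mult)
    also have "\<dots> \<le> e / 2 * T + B"
    proof -
      have "e / 2 * (T - t) \<le> e / 2 * T"
        using assms(2) e by (intro mult_left_mono) auto
      then show ?thesis
        using K[of T] elim B_def by linarith
    qed
    also have "\<dots> < e / 2 * T + e / 2 * T"
      using elim e by (simp add: field_simps)
    also have "\<dots> = T * e" by simp
    finally show ?case
      using elim by (simp add: dist_real_def)
  qed
qed

text \<open>Where x exceeds \<epsilon>, the factor (x / \<epsilon>)^3 is at least 1. Integrated over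
  time, a bounded total fourth power thus leaves only \<epsilon> per unit of time.\<close>

lemma le_add_power4_div:
  fixes x \<epsilon> :: real
  assumes "0 < \<epsilon>" "0 \<le> x"
  shows "x \<le> \<epsilon> + x ^ 4 / \<epsilon> ^ 3"
proof (cases "x \<le> \<epsilon>")
  case True
  then show ?thesis using assms by (simp add: add_increasing2)
next
  case False
  then have "x * \<epsilon> ^ 3 \<le> x * x ^ 3"
    using assms by (intro mult_left_mono power_mono) auto
  then have "x \<le> x ^ 4 / \<epsilon> ^ 3"
    using assms by (simp add: field_simps power4_eq_xxxx power3_eq_cube)
  then show ?thesis using assms by simp
qed

text \<open>With r = sqrt p this is the square of r^2 * (1 - r)^2 \<le> r^2 * (1 - r) * (1 + r). The
  fourth power is what compares with a squared variance.\<close>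

lemma sqrt_diff_power4_le:
  fixes p :: real
  assumes "0 \<le> p" "p \<le> 1"
  shows "(sqrt p - p) ^ 4 \<le> (p * (1 - p))\<^sup>2"
proof -
  define r where "r = sqrt p"
  have r: "0 \<le> r" "r \<le> 1" "p = r\<^sup>2"
    using assms by (auto simp: r_def)
  have "(1 - r)\<^sup>2 \<le> (1 - r) * (1 + r)"
    using r by (simp add: power2_eq_square mult_left_mono)
  then have "r\<^sup>2 * (1 - r)\<^sup>2 \<le> r\<^sup>2 * ((1 - r) * (1 + r))"
    by (intro mult_left_mono) auto
  then have "(sqrt p - p)\<^sup>2 \<le> p * (1 - p)"
    using r by (simp add: r_def[symmetric] power2_eq_square algebra_simps)
  then have "((sqrt p - p)\<^sup>2)\<^sup>2 \<le> (p * (1 - p))\<^sup>2"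
    by (intro power_mono) auto
  then show ?thesis by (simp flip: power_mult)
qed

section \<open>Linear functionals without drift after the control phase\<close>

context wiener
begin

text \<open>A solution relates each time to integrals starting at \<open>t\<close>. After
  \<open>t\<^sub>0\<close> the drift integrals cancel, and the increment of the functional is a
  difference of two Ito integrals with the same starting point.\<close>

lemma sme_increment:
  fixes \<ll> :: "'n::finite cmat \<Rightarrow> real"
  assumes sol: "sme_solution M F W \<eta> H L t A \<rho>" and lin: "bounded_linear \<ll>"
    and t: "0 \<le> t" "t \<le> t\<^sub>0" "t\<^sub>0 \<le> s"
    and drift: "\<And>r A. t\<^sub>0 < r \<Longrightarrow> \<ll> (sme_drift (H r) L A) = 0"
  obtains I\<^sub>0 I where
    "has_ito_integral M F W t t\<^sub>0 (\<lambda>r \<omega>. \<ll> (sme_diffusion \<eta> L (\<rho> r \<omega>))) I\<^sub>0"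
    "has_ito_integral M F W t s (\<lambda>r \<omega>. \<ll> (sme_diffusion \<eta> L (\<rho> r \<omega>))) I"
    "AE \<omega> in M. \<ll> (\<rho> s \<omega>) = \<ll> (\<rho> t\<^sub>0 \<omega>) + (I \<omega> - I\<^sub>0 \<omega>)"
proof -
  interpret bounded_linear \<ll> by fact
  have ex: "\<exists>I. has_ito_integral M F W t s' (\<lambda>r \<omega>. sme_diffusion \<eta> L (\<rho> r \<omega>)) I \<and>
        (AE \<omega> in M. integrable (lebesgue_on {t..s'}) (\<lambda>r. sme_drift (H r) L (\<rho> r \<omega>)) \<and>
           \<rho> s' \<omega> = A + (LINT r|lebesgue_on {t..s'}. sme_drift (H r) L (\<rho> r \<omega>)) + I \<omega>)" if "t \<le> s'" for s'
    using sol that by (simp add: sme_solution_def)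
  obtain J\<^sub>0 where J0: "has_ito_integral M F W t t\<^sub>0 (\<lambda>r \<omega>. sme_diffusion \<eta> L (\<rho> r \<omega>)) J\<^sub>0"
    "AE \<omega> in M. integrable (lebesgue_on {t..t\<^sub>0}) (\<lambda>r. sme_drift (H r) L (\<rho> r \<omega>)) \<and>
           \<rho> t\<^sub>0 \<omega> = A + (LINT r|lebesgue_on {t..t\<^sub>0}. sme_drift (H r) L (\<rho> r \<omega>)) + J\<^sub>0 \<omega>"
    using ex[OF t(2)] by blast
  obtain J where J: "has_ito_integral M F W t s (\<lambda>r \<omega>. sme_diffusion \<eta> L (\<rho> r \<omega>)) J"
    "AE \<omega> in M. integrable (lebesgue_on {t..s}) (\<lambda>r. sme_drift (H r) L (\<rho> r \<omega>)) \<and>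
           \<rho> s \<omega> = A + (LINT r|lebesgue_on {t..s}. sme_drift (H r) L (\<rho> r \<omega>)) + J \<omega>"
    using ex[OF order_trans[OF t(2,3)]] by blast
  \<comment> \<open>The integrands, extended by zero, coincide, so this holds for every \<omega>,
    even where the integral takes its default value.\<close>
  have same: "(LINT r|lebesgue_on {t..s}. \<ll> (sme_drift (H r) L (\<rho> r \<omega>)))
      = (LINT r|lebesgue_on {t..t\<^sub>0}. \<ll> (sme_drift (H r) L (\<rho> r \<omega>)))" for \<omega>
  proof -
    have "indicat_real {t..s} r *\<^sub>R \<ll> (sme_drift (H r) L (\<rho> r \<omega>))
        = indicat_real {t..t\<^sub>0} r *\<^sub>R \<ll> (sme_drift (H r) L (\<rho> r \<omega>))" for r
      using drift[of r "\<rho> r \<omega>"] t(3) by (cases "t\<^sub>0 < r") (auto simp: indicator_def)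
    moreover have "(LINT r|lebesgue_on {a..b}. f r) = (LINT r|lebesgue. indicator {a..b} r *\<^sub>R f r)"
      for a b and f :: "real \<Rightarrow> real"
      by (rule integral_restrict_space) simp
    ultimately show ?thesis by presburger
  qed
  have "AE \<omega> in M. \<ll> (\<rho> s \<omega>) = \<ll> (\<rho> t\<^sub>0 \<omega>) + (\<ll> (J \<omega>) - \<ll> (J\<^sub>0 \<omega>))"
    using J0(2) J(2)
  proof eventually_elim
    case (elim \<omega>)
    have "\<ll> (\<rho> s \<omega>) = \<ll> A + (LINT r|lebesgue_on {t..s}. \<ll> (sme_drift (H r) L (\<rho> r \<omega>))) + \<ll> (J \<omega>)"
      using elim integral_bounded_linear[OF lin conjunct1[OF elim(2)]] by (simp add: add)
    moreover have "\<ll> (\<rho> t\<^sub>0 \<omega>) = \<ll> A + (LINT r|lebesgue_on {t..t\<^sub>0}. \<ll> (sme_drift (H r) L (\<rho> r \<omega>))) + \<ll> (J\<^sub>0 \<omega>)"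
      using elim integral_bounded_linear[OF lin conjunct1[OF elim(1)]] by (simp add: add)
    ultimately show ?case by (simp add: same)
  qed
  then show thesis
    using that has_ito_integral_linear[OF lin t(1) J0(1)] has_ito_integral_linear[OF lin t(1) J(1)] by blast
qed

lemma sme_measurable:
  fixes \<ll> :: "'n::finite cmat \<Rightarrow> real"
  assumes "sme_solution M F W \<eta> H L t A \<rho>" "bounded_linear \<ll>" "t \<le> s"
  shows "(\<lambda>\<omega>. \<ll> (\<rho> s \<omega>)) \<in> borel_measurable M"
proof -
  have "\<rho> s \<in> borel_measurable M"
    using assms(1,3) by (intro measurable_F_M[of _ s]) (simp add: sme_solution_def)
  moreover have "\<ll> \<in> borel_measurable borel"
    using assms(2) by (intro borel_measurable_continuous_onI linear_continuous_on)
  ultimately show ?thesis by (rule measurable_compose)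
qed

lemma sme_integrable:
  fixes \<rho> :: "real \<Rightarrow> 'w \<Rightarrow> 'n::finite cmat"
  assumes sol: "sme_solution M F W \<eta> H L t A \<rho>" and "t \<le> s"
  shows "integrable M (\<rho> s)"
proof (rule integrable_const_bound)
  show "AE \<omega> in M. norm (\<rho> s \<omega>) \<le> 4 * (real CARD('n))\<^sup>2"
    using assms by (intro AE_I2 density_norm_bound) (simp add: sme_solution_def)
  show "\<rho> s \<in> borel_measurable M"
    using assms by (intro measurable_F_M[of _ s]) (simp add: sme_solution_def)
qed

lemma sme_expectation_constant:
  fixes \<ll> :: "'n::finite cmat \<Rightarrow> real"
  assumes sol: "sme_solution M F W \<eta> H L t A \<rho>" and lin: "bounded_linear \<ll>"
    and t: "0 \<le> t" "t \<le> t\<^sub>0" "t\<^sub>0 \<le> s"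
    and drift: "\<And>r A. t\<^sub>0 < r \<Longrightarrow> \<ll> (sme_drift (H r) L A) = 0"
  shows "expectation (\<lambda>\<omega>. \<ll> (\<rho> s \<omega>)) = expectation (\<lambda>\<omega>. \<ll> (\<rho> t\<^sub>0 \<omega>))"
proof -
  obtain I\<^sub>0 I where
    I0: "has_ito_integral M F W t t\<^sub>0 (\<lambda>r \<omega>. \<ll> (sme_diffusion \<eta> L (\<rho> r \<omega>))) I\<^sub>0" and
    I: "has_ito_integral M F W t s (\<lambda>r \<omega>. \<ll> (sme_diffusion \<eta> L (\<rho> r \<omega>))) I" and
    eq: "AE \<omega> in M. \<ll> (\<rho> s \<omega>) = \<ll> (\<rho> t\<^sub>0 \<omega>) + (I \<omega> - I\<^sub>0 \<omega>)"
    using sme_increment[OF sol lin t drift] by blast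
  have int: "integrable M I" "integrable M I\<^sub>0" "expectation I = 0" "expectation I\<^sub>0 = 0"
    using ito_integral_integrable ito_integral_expectation I I0 t(1) by blast+
  have int': "integrable M (\<lambda>\<omega>. \<ll> (\<rho> t\<^sub>0 \<omega>))" "integrable M (\<lambda>\<omega>. \<ll> (\<rho> s \<omega>))"
    using sme_integrable[OF sol] t by (auto intro!: integrable_bounded_linear[OF lin])
  have "expectation (\<lambda>\<omega>. \<ll> (\<rho> s \<omega>)) = expectation (\<lambda>\<omega>. \<ll> (\<rho> t\<^sub>0 \<omega>) + (I \<omega> - I\<^sub>0 \<omega>))"
    using eq int int' by (intro integral_cong_AE) auto
  then show ?thesis
    using int int' by simp
qed

text \<open>The decisive feature is that \<open>C\<close> does not depend on \<open>s\<close>: a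
  driftless functional that stays bounded can accumulate only bounded expected quadratic variation,
  however long the horizon.\<close>

lemma sme_diffusion_square_bounded:
  fixes \<ll> :: "'n::finite cmat \<Rightarrow> real"
  assumes sol: "sme_solution M F W \<eta> H L t A \<rho>" and lin: "bounded_linear \<ll>"
    and t: "0 \<le> t" "t \<le> t\<^sub>0"
    and drift: "\<And>r A. t\<^sub>0 < r \<Longrightarrow> \<ll> (sme_drift (H r) L A) = 0"
  obtains C where "0 \<le> C" "\<And>s. t\<^sub>0 \<le> s \<Longrightarrow> (\<integral>\<^sup>+ \<omega>. (\<integral>\<^sup>+ r\<in>{t..s}.
      ennreal ((\<ll> (sme_diffusion \<eta> L (\<rho> r \<omega>)))\<^sup>2) \<partial>lborel) \<partial>M) \<le> ennreal C"
proof -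
  let ?N = "\<lambda>s. \<integral>\<^sup>+ \<omega>. (\<integral>\<^sup>+ r\<in>{t..s}. ennreal ((\<ll> (sme_diffusion \<eta> L (\<rho> r \<omega>)))\<^sup>2) \<partial>lborel) \<partial>M"
  interpret bounded_linear \<ll> by fact
  obtain K where K: "0 \<le> K" "\<And>x. norm (\<ll> x) \<le> norm x * K"
    using nonneg_bounded by blast
  define B where "B = 4 * (real CARD('n))\<^sup>2 * K"
  have B: "\<bar>\<ll> (\<rho> s \<omega>)\<bar> \<le> B" if "t \<le> s" "\<omega> \<in> space M" for s \<omega>
  proof -
    have "density_matrix (\<rho> s \<omega>)"
      using sol that by (simp add: sme_solution_def)
    then have "norm (\<rho> s \<omega>) * K \<le> B"
      unfolding B_def by (intro mult_right_mono density_norm_bound K)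
    then show ?thesis
      using K(2)[of "\<rho> s \<omega>"] by simp
  qed
  \<comment> \<open>The contribution of the control phase; its finiteness is part of having an Ito
    integral.\<close>
  have N0: "?N t\<^sub>0 < \<infinity>"
  proof -
    obtain I\<^sub>0 where "has_ito_integral M F W t t\<^sub>0 (\<lambda>r \<omega>. \<ll> (sme_diffusion \<eta> L (\<rho> r \<omega>))) I\<^sub>0"
      using sme_increment[OF sol lin t order_refl drift] by blast
    then show ?thesis by (simp add: has_ito_integral_def)
  qed
  \<comment> \<open>Factors 4 come from the two isometry inequalities, factors 2 from writing I as
    (I - I0) + I0; the difference is an increment of the functional, hence at most 2 * B in
    size.\<close>
  have "?N s \<le> 4 * (2 * ennreal ((2 * B)\<^sup>2) + 2 * (4 * ?N t\<^sub>0))" if s: "t\<^sub>0 \<le> s" for s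
  proof -
    obtain I\<^sub>0 I where
      I0: "has_ito_integral M F W t t\<^sub>0 (\<lambda>r \<omega>. \<ll> (sme_diffusion \<eta> L (\<rho> r \<omega>))) I\<^sub>0" and
      I: "has_ito_integral M F W t s (\<lambda>r \<omega>. \<ll> (sme_diffusion \<eta> L (\<rho> r \<omega>))) I" and
      eq: "AE \<omega> in M. \<ll> (\<rho> s \<omega>) = \<ll> (\<rho> t\<^sub>0 \<omega>) + (I \<omega> - I\<^sub>0 \<omega>)"
      using sme_increment[OF sol lin t s drift] by blast
    have m: "I \<in> borel_measurable M" "I\<^sub>0 \<in> borel_measurable M"
      using I I0 by (auto simp: has_ito_integral_def)
    have "(\<integral>\<^sup>+ \<omega>. ennreal ((I \<omega>)\<^sup>2) \<partial>M)
        \<le> 2 * (\<integral>\<^sup>+ \<omega>. ennreal ((I \<omega> - I\<^sub>0 \<omega>)\<^sup>2) \<partial>M) + 2 * (\<integral>\<^sup>+ \<omega>. ennreal ((I\<^sub>0 \<omega>)\<^sup>2) \<partial>M)"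
      using m by (rule nn_integral_square_triangle)
    also have "(\<integral>\<^sup>+ \<omega>. ennreal ((I \<omega> - I\<^sub>0 \<omega>)\<^sup>2) \<partial>M) \<le> (\<integral>\<^sup>+ \<omega>. ennreal ((2 * B)\<^sup>2) \<partial>M)"
    proof (rule nn_integral_mono_AE)
      have bound: "(\<ll> (\<rho> s \<omega>) - \<ll> (\<rho> t\<^sub>0 \<omega>))\<^sup>2 \<le> (2 * B)\<^sup>2" if "\<omega> \<in> space M" for \<omega>
        using B[OF _ that, of s] B[OF _ that, of t\<^sub>0] s t by (intro power2_le_iff_abs_le[THEN iffD2]) auto
      from eq AE_space[of M] show "AE \<omega> in M. ennreal ((I \<omega> - I\<^sub>0 \<omega>)\<^sup>2) \<le> ennreal ((2 * B)\<^sup>2)"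
        proof eventually_elim
          case (elim \<omega>)
          then show ?case using bound[of \<omega>] by (intro ennreal_leI) simp
        qed
    qed
    also have "(\<integral>\<^sup>+ \<omega>. ennreal ((2 * B)\<^sup>2) \<partial>M) = ennreal ((2 * B)\<^sup>2)"
      by (simp add: emeasure_space_1)
    also have "(\<integral>\<^sup>+ \<omega>. ennreal ((I\<^sub>0 \<omega>)\<^sup>2) \<partial>M) \<le> 4 * ?N t\<^sub>0"
      using ito_integral_square_le[OF I0 t(1)] .
    finally have "(\<integral>\<^sup>+ \<omega>. ennreal ((I \<omega>)\<^sup>2) \<partial>M) \<le> 2 * ennreal ((2 * B)\<^sup>2) + 2 * (4 * ?N t\<^sub>0)"
      by (simp add: add_mono mult_left_mono)
    then show ?thesis
      using ito_integrand_square_le[OF I t(1)] by (meson mult_left_mono order_trans zero_le)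
  qed
  moreover have "4 * (2 * ennreal ((2 * B)\<^sup>2) + 2 * (4 * ?N t\<^sub>0)) < \<infinity>"
    using N0 by (auto simp: ennreal_mult_less_top)
  ultimately show thesis
    by (intro that[of "enn2real (4 * (2 * ennreal ((2 * B)\<^sup>2) + 2 * (4 * ?N t\<^sub>0)))"])
      (simp_all only: enn2real_nonneg ennreal_enn2real infinity_ennreal_def)
qed

end

text \<open>The weighted sum is 2 * sqrt \<eta> times the variance, which dominates p * (1 - p);
  squaring gives the factor 4 * \<eta>.\<close>

lemma population_gap_le_diffusion:
  assumes "density_matrix A" "0 < \<eta>" and gap: "\<And>i. i \<noteq> k \<Longrightarrow> 1 \<le> \<bar>d i - d k\<bar>"
  shows "4 * \<eta> * (sqrt (population A k) - population A k) ^ 4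
    \<le> (\<Sum>i\<in>UNIV. d i * population (sme_diffusion \<eta> (real_diag d) A) i)\<^sup>2"
proof -
  define a where "a = population A"
  define m where "m = (\<Sum>i\<in>UNIV. d i * a i)"
  define V where "V = (\<Sum>i\<in>UNIV. (d i)\<^sup>2 * a i) - m\<^sup>2"
  have herm: "hermitian A"
    using assms(1) by (simp add: density_matrix_def psd_def)
  have a: "0 \<le> a i" "a i \<le> 1" "sum a UNIV = 1" for i
    using density_population_bounds[OF assms(1)] density_population_sum[OF assms(1)] by (auto simp: a_def)
  have "(\<Sum>i\<in>UNIV. d i * population (sme_diffusion \<eta> (real_diag d) A) i)
      = (\<Sum>i\<in>UNIV. 2 * sqrt \<eta> * ((d i)\<^sup>2 * a i - m * (d i * a i)))"
    by (intro sum.cong) (auto simp: population_diffusion_diag[OF herm] m_def a_def power2_eq_square algebra_simps)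
  also have "\<dots> = 2 * sqrt \<eta> * V"
    unfolding V_def by (simp add: sum_subtractf power2_eq_square m_def flip: sum_distrib_left)
  finally have eq: "(\<Sum>i\<in>UNIV. d i * population (sme_diffusion \<eta> (real_diag d) A) i)\<^sup>2 = 4 * \<eta> * V\<^sup>2"
    using assms(2) by (simp add: power_mult_distrib)
  have "a k * (1 - a k) \<le> V"
    unfolding V_def m_def using a gap by (intro mult_complement_le_variance) auto
  then have "(a k * (1 - a k))\<^sup>2 \<le> V\<^sup>2"
    using a by (intro power_mono) auto
  then have "(sqrt (a k) - a k) ^ 4 \<le> V\<^sup>2"
    using sqrt_diff_power4_le[of "a k"] a by (meson order_trans)
  then show ?thesis
    unfolding eq a_def[symmetric] using assms(2) by (intro mult_left_mono) auto
qed

lemma (in prob_space) prob_space_times_interval: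
  assumes "t \<le> (T::real)"
  shows "finite_measure (M \<Otimes>\<^sub>M restrict_space lborel {t..T})"
    "measure (M \<Otimes>\<^sub>M restrict_space lborel {t..T}) (space (M \<Otimes>\<^sub>M restrict_space lborel {t..T})) = T - t"
proof -
  interpret R: sigma_finite_measure "restrict_space lborel {t..T}"
    by (rule sigma_finite_restrict_lborel)
  have "emeasure (M \<Otimes>\<^sub>M restrict_space lborel {t..T}) (space (M \<Otimes>\<^sub>M restrict_space lborel {t..T}))
      = emeasure M (space M) * emeasure (restrict_space lborel {t..T}) (space (restrict_space lborel {t..T}))"
    unfolding space_pair_measure by (intro R.emeasure_pair_measure_Times sets.top)
  also have "\<dots> = ennreal (T - t)"
    using assms by (simp add: emeasure_space_1 space_restrict_space emeasure_restrict_space)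
  finally have e: "emeasure (M \<Otimes>\<^sub>M restrict_space lborel {t..T}) (space (M \<Otimes>\<^sub>M restrict_space lborel {t..T})) = ennreal (T - t)" .
  then show "finite_measure (M \<Otimes>\<^sub>M restrict_space lborel {t..T})"
    by (intro finite_measureI) simp
  show "measure (M \<Otimes>\<^sub>M restrict_space lborel {t..T}) (space (M \<Otimes>\<^sub>M restrict_space lborel {t..T})) = T - t"
    using assms by (simp add: measure_def e)
qed

text \<open>The integrand leaves \<open>c\<close> only before \<open>t\<^sub>0\<close>, and then by
  at most 1, since \<open>c\<close> is itself one of its values. The control phase thus costs no
  more than its length.\<close>

lemma integral_eventually_constant:
  fixes G :: "real \<Rightarrow> real"
  assumes "t \<le> t\<^sub>0" "t\<^sub>0 \<le> T" and int: "integrable (restrict_space lborel {t..T}) G"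
    and unit: "\<And>s. t \<le> s \<Longrightarrow> G s \<in> {0..1}" and const: "\<And>s. t\<^sub>0 \<le> s \<Longrightarrow> G s = c"
  shows "\<bar>(LINT s|restrict_space lborel {t..T}. G s) - c * (T - t)\<bar> \<le> t\<^sub>0 - t"
proof -
  let ?R = "restrict_space lborel {t..T}"
  have c: "c \<in> {0..1}"
    using unit[of t\<^sub>0] const[of t\<^sub>0] assms(1) by auto
  have ind: "(\<lambda>s. indicat_real {t..T} s *\<^sub>R indicat_real {t..t\<^sub>0} s) = indicat_real {t..t\<^sub>0}"
    using assms(2) by (auto simp: fun_eq_iff indicator_def)
  have intc: "integrable ?R (\<lambda>_. c)"
    by (auto simp: integrable_restrict_space emeasure_lborel_Icc_eq)
  have "(LINT s|?R. c) = c * (T - t)"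
    using assms(1,2) by (subst integral_restrict_space) auto
  then have "(LINT s|?R. G s) - c * (T - t) = (LINT s|?R. G s - c)"
    by (simp only: Bochner_Integration.integral_diff[OF int intc])
  also have "\<bar>\<dots>\<bar> \<le> (LINT s|?R. \<bar>G s - c\<bar>)"
    by (rule integral_abs_bound)
  also have "\<dots> \<le> (LINT s|?R. indicator {t..t\<^sub>0} s)"
  proof (rule integral_mono)
    show "integrable ?R (\<lambda>s. \<bar>G s - c\<bar>)" using int intc by simp
    show "integrable ?R (indicat_real {t..t\<^sub>0})"
      by (subst integrable_restrict_space) (simp_all only: ind, simp_all add: emeasure_lborel_Icc_eq)
    fix s assume "s \<in> space ?R"
    then show "\<bar>G s - c\<bar> \<le> indicat_real {t..t\<^sub>0} s"
      using unit[of s] const[of s] c by (cases "s \<le> t\<^sub>0") (auto simp: space_restrict_space indicator_def)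
  qed
  also have "\<dots> = (LINT s|lborel. indicator {t..t\<^sub>0} s)"
    by (subst integral_restrict_space) (simp_all only: ind, simp_all)
  also have "\<dots> = t\<^sub>0 - t"
    using assms(1) by simp
  finally show ?thesis .
qed

section \<open>Time average of the Bures cost\<close>

context wiener
begin

lemma average_cost_limit:
  fixes \<rho> :: "real \<Rightarrow> 'w \<Rightarrow> 'n::finite cmat"
  assumes sol: "sme_solution M F W \<eta> H (real_diag d) t A \<rho>" and \<eta>: "0 < \<eta>"
    and t: "0 \<le> t" "t < t\<^sub>0" and free: "\<And>r. t\<^sub>0 < r \<Longrightarrow> H r = real_diag d"
    and gap: "\<And>i. i \<noteq> k \<Longrightarrow> 1 \<le> \<bar>d i - d k\<bar>"
  shows "(average_cost M t (basis_proj k) \<rho>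
    \<longlongrightarrow> 2 * (1 - expectation (\<lambda>\<omega>. population (\<rho> t\<^sub>0 \<omega>) k))) at_top"
proof (rule tendsto_of_linear_growth[OF _ t(1)])
  fix \<epsilon> :: real assume \<epsilon>: "0 < \<epsilon>"
  define p where "p s \<omega> = population (\<rho> s \<omega>) k" for s \<omega>
  \<comment> \<open>The part of the cost that is not linear in the state.\<close>
  define q where "q s \<omega> = sqrt (p s \<omega>) - p s \<omega>" for s \<omega>
  \<comment> \<open>The measured mean, that is the trace of \<open>real_diag d ** B\<close> for
    Hermitian \<open>B\<close>.\<close>
  define \<ll> :: "'n cmat \<Rightarrow> real" where "\<ll> B = (\<Sum>i\<in>UNIV. d i * population B i)" for B
  define c where "c = 1 - expectation (\<lambda>\<omega>. population (\<rho> t\<^sub>0 \<omega>) k)"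
  have lin: "bounded_linear \<ll>"
    unfolding \<ll>_def by (intro bounded_linear_sum bounded_linear_const_mult bounded_linear_population)
  have dens: "density_matrix (\<rho> s \<omega>)" if "t \<le> s" "\<omega> \<in> space M" for s \<omega>
    using sol that by (simp add: sme_solution_def)
  have p: "0 \<le> p s \<omega>" "p s \<omega> \<le> 1" if "t \<le> s" "\<omega> \<in> space M" for s \<omega>
    using density_population_bounds[OF dens[OF that]] by (simp_all add: p_def)
  have q: "0 \<le> q s \<omega>" "q s \<omega> \<le> 1" if "t \<le> s" "\<omega> \<in> space M" for s \<omega>
  proof -
    have "p s \<omega> \<le> sqrt (p s \<omega>)" "sqrt (p s \<omega>) \<le> 1"
      using p[OF that] mult_left_le[of "p s \<omega>" "p s \<omega>"] by (auto intro!: real_le_rsqrt simp: power2_eq_square)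
    then show "0 \<le> q s \<omega>" "q s \<omega> \<le> 1"
      using p[OF that] unfolding q_def by linarith+
  qed
  have drift0: "\<ll> (sme_drift (H r) (real_diag d) B) = 0" if "t\<^sub>0 < r" for r B
    using free[OF that] by (simp add: \<ll>_def population_drift_diag)
  obtain C where C: "0 \<le> C" "\<And>s. t\<^sub>0 \<le> s \<Longrightarrow> (\<integral>\<^sup>+ \<omega>. (\<integral>\<^sup>+ r\<in>{t..s}.
      ennreal ((\<ll> (sme_diffusion \<eta> (real_diag d) (\<rho> r \<omega>)))\<^sup>2) \<partial>lborel) \<partial>M) \<le> ennreal C"
    using sme_diffusion_square_bounded[OF sol lin t(1) less_imp_le[OF t(2)] drift0] by blast
  have mean: "expectation (p s) = expectation (p t\<^sub>0)" if "t\<^sub>0 \<le> s" for s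
    unfolding p_def
    using sol bounded_linear_population t(1) less_imp_le[OF t(2)] that
    by (rule sme_expectation_constant) (simp add: free population_drift_diag)
  have meas: "p s \<in> borel_measurable M" if "t \<le> s" for s
    unfolding p_def using sme_measurable[OF sol bounded_linear_population that] .
  have cont: "continuous_on {t..} (\<lambda>s. p s \<omega>)" if "\<omega> \<in> space M" for \<omega>
    unfolding p_def using sol that
    by (intro bounded_linear.continuous_on[OF bounded_linear_population]) (simp add: sme_solution_def)
  \<comment> \<open>In the witness, 2 * (t0 - t) covers the linear part during the control phase,
    and the remaining term is twice C / (4 * \<eta>) divided by (\<epsilon> / 2)^3.\<close>
  show "\<exists>K. \<forall>T\<ge>t\<^sub>0. \<bar>T * average_cost M t (basis_proj k) \<rho> T
      - 2 * (1 - expectation (\<lambda>\<omega>. population (\<rho> t\<^sub>0 \<omega>) k)) * (T - t)\<bar> \<le> \<epsilon> * (T - t) + K"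
  proof (intro exI[of _ "2 * (t\<^sub>0 - t) + C / (2 * \<eta> * (\<epsilon> / 2) ^ 3)"] allI impI)
    fix T assume T: "t\<^sub>0 \<le> T"
    let ?R = "restrict_space lborel {t..T}" let ?N = "M \<Otimes>\<^sub>M ?R"
    interpret R: sigma_finite_measure ?R
      by (rule sigma_finite_restrict_lborel)
    interpret pair_sigma_finite M ?R ..
    interpret N: finite_measure ?N
      using T t by (intro prob_space_times_interval) auto
    have measN: "measure ?N (space ?N) = T - t"
      using T t by (intro prob_space_times_interval) auto
    have space: "fst z \<in> space M" "t \<le> snd z" if "z \<in> space ?N" for z
      using that by (auto simp: space_pair_measure space_restrict_space)
    have [measurable]: "(\<lambda>z. p (snd z) (fst z)) \<in> borel_measurable ?N"
      using continuous_process_measurable[OF meas cont, where b=T] by (simp add: split_beta')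
    have [measurable]: "(\<lambda>z. q (snd z) (fst z)) \<in> borel_measurable ?N"
      unfolding q_def by measurable
    have intp: "integrable ?N (\<lambda>z. p (snd z) (fst z))"
      using p space by (intro N.integrable_const_bound[where B=1] AE_I2) auto
    have intq: "integrable ?N (\<lambda>z. q (snd z) (fst z))"
      using q space by (intro N.integrable_const_bound[where B=1] AE_I2) auto
    have intq4: "integrable ?N (\<lambda>z. q (snd z) (fst z) ^ 4)"
      using q space by (intro N.integrable_const_bound[where B=1] AE_I2) (auto intro!: power_le_one)
    have "ennreal (4 * \<eta> * (\<integral>z. q (snd z) (fst z) ^ 4 \<partial>?N)) \<le> ennreal C"
    proof -
      have "ennreal (4 * \<eta> * (\<integral>z. q (snd z) (fst z) ^ 4 \<partial>?N)) = (\<integral>\<^sup>+z. ennreal (4 * \<eta> * q (snd z) (fst z) ^ 4) \<partial>?N)"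
        using intq4 \<eta> by (subst nn_integral_eq_integral) auto
      also have "\<dots> = (\<integral>\<^sup>+ \<omega>. (\<integral>\<^sup>+ s\<in>{t..T}. ennreal (4 * \<eta> * q s \<omega> ^ 4) \<partial>lborel) \<partial>M)"
        by (subst iterated_nn_integral) (auto simp: split_beta')
      also have "\<dots> \<le> (\<integral>\<^sup>+ \<omega>. (\<integral>\<^sup>+ r\<in>{t..T}.
          ennreal ((\<ll> (sme_diffusion \<eta> (real_diag d) (\<rho> r \<omega>)))\<^sup>2) \<partial>lborel) \<partial>M)"
        unfolding q_def p_def \<ll>_def
        by (intro nn_integral_mono)
          (auto intro!: ennreal_leI population_gap_le_diffusion dens \<eta> gap simp: indicator_def)
      also have "\<dots> \<le> ennreal C"
        by (rule C(2)[OF T])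
      finally show ?thesis .
    qed
    then have q4: "(\<integral>z. q (snd z) (fst z) ^ 4 \<partial>?N) \<le> C / (4 * \<eta>)"
      using C(1) \<eta> by (simp add: field_simps)
    \<comment> \<open>Applied with \<epsilon> / 2, because the cost contains \<open>q\<close>
      twice.\<close>
    have "(\<integral>z. q (snd z) (fst z) \<partial>?N) \<le> (\<integral>z. \<epsilon> / 2 + q (snd z) (fst z) ^ 4 / (\<epsilon> / 2) ^ 3 \<partial>?N)"
      using intq intq4 \<epsilon> q space by (intro integral_mono) (auto intro!: le_add_power4_div)
    also have "\<dots> = \<epsilon> / 2 * (T - t) + (\<integral>z. q (snd z) (fst z) ^ 4 \<partial>?N) / (\<epsilon> / 2) ^ 3"
      using intq4 measN by (subst Bochner_Integration.integral_add) auto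
    also have "\<dots> \<le> \<epsilon> / 2 * (T - t) + C / (4 * \<eta>) / (\<epsilon> / 2) ^ 3"
      using q4 \<epsilon> by (intro add_left_mono divide_right_mono) auto
    finally have Q: "2 * (\<integral>z. q (snd z) (fst z) \<partial>?N) \<le> \<epsilon> * (T - t) + C / (2 * \<eta> * (\<epsilon> / 2) ^ 3)"
      by simp
    \<comment> \<open>\<open>q\<close> enters the cost negatively: its sign controls the final
      estimate from above, the bound \<open>Q\<close> from below.\<close>
    have Q0: "0 \<le> (\<integral>z. q (snd z) (fst z) \<partial>?N)"
      using q space by (intro Bochner_Integration.integral_nonneg) auto
    have int1p: "integrable ?N (\<lambda>(\<omega>, s). 1 - p s \<omega>)"
      using intp by (simp add: split_beta')
    have P: "\<bar>(\<integral>z. 1 - p (snd z) (fst z) \<partial>?N) - c * (T - t)\<bar> \<le> t\<^sub>0 - t"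
    proof -
      \<comment> \<open>Time is integrated last here, so that the constant mean can be used; the
        cost itself, further down, integrates over the noise last.\<close>
      have "(\<integral>z. 1 - p (snd z) (fst z) \<partial>?N) = (LINT s|?R. expectation (\<lambda>\<omega>. 1 - p s \<omega>))"
        using integral_snd[OF int1p] by (simp add: split_beta')
      moreover have pint: "integrable M (p s)" if "t \<le> s" for s
        using p that meas by (intro integrable_const_bound[where B=1] AE_I2) auto
      then have E: "expectation (\<lambda>\<omega>. 1 - p s \<omega>) = 1 - expectation (p s)" if "t \<le> s" for s
        using that by (simp add: prob_space)
      have "\<bar>(LINT s|?R. expectation (\<lambda>\<omega>. 1 - p s \<omega>)) - c * (T - t)\<bar> \<le> t\<^sub>0 - t"
      proof (rule integral_eventually_constant)
        show "integrable ?R (\<lambda>s. expectation (\<lambda>\<omega>. 1 - p s \<omega>))"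
          using integrable_snd[OF int1p] .
        show "expectation (\<lambda>\<omega>. 1 - p s \<omega>) \<in> {0..1}" if "t \<le> s" for s
        proof -
          have "0 \<le> expectation (p s)" "expectation (p s) \<le> 1"
            using p[OF that] pint[OF that] by (auto intro!: integral_nonneg_AE integral_le_const)
          then show ?thesis by (simp add: E[OF that])
        qed
        show "expectation (\<lambda>\<omega>. 1 - p s \<omega>) = c" if "t\<^sub>0 \<le> s" for s
          using E[of s] mean[OF that] t that by (simp add: c_def p_def[abs_def])
      qed (use t T in auto)
      ultimately show ?thesis by simp
    qed
    have "T * average_cost M t (basis_proj k) \<rho> T
        = expectation (\<lambda>\<omega>. LINT s|lebesgue_on {t..T}. (bures_dist (\<rho> s \<omega>) (basis_proj k))\<^sup>2)"
      using t T by (simp add: average_cost_def)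
    also have "\<dots> = expectation (\<lambda>\<omega>. LINT s|?R. 2 * (1 - p s \<omega>) - 2 * q s \<omega>)"
    proof (rule Bochner_Integration.integral_cong[OF refl])
      fix \<omega> assume \<omega>: "\<omega> \<in> space M"
      have "(\<lambda>s. p s \<omega>) \<in> borel_measurable (restrict_space borel {t..T})"
        using continuous_on_subset[OF cont[OF \<omega>], of "{t..T}"]
        by (intro borel_measurable_continuous_on_restrict) auto
      then have [measurable]: "(\<lambda>s. p s \<omega>) \<in> borel_measurable ?R"
        by (simp add: measurable_cong_sets[OF sets_restrict_space_cong[OF sets_lborel] refl])
      have m: "(\<lambda>s. 2 * (1 - p s \<omega>) - 2 * q s \<omega>) \<in> borel_measurable ?R"
        unfolding q_def by measurable
      have "(LINT s|lebesgue_on {t..T}. (bures_dist (\<rho> s \<omega>) (basis_proj k))\<^sup>2)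
          = (LINT s|lebesgue_on {t..T}. 2 * (1 - p s \<omega>) - 2 * q s \<omega>)"
        using \<omega> by (intro Bochner_Integration.integral_cong) (auto simp: bures_dist_basis_proj[OF dens] p_def q_def)
      then show "(LINT s|lebesgue_on {t..T}. (bures_dist (\<rho> s \<omega>) (basis_proj k))\<^sup>2)
          = (LINT s|?R. 2 * (1 - p s \<omega>) - 2 * q s \<omega>)"
        using integral_lebesgue_on_eq_lborel[OF m] by simp
    qed
    also have "\<dots> = (\<integral>z. 2 * (1 - p (snd z) (fst z)) - 2 * q (snd z) (fst z) \<partial>?N)"
      using integral_fst'[of "\<lambda>z. 2 * (1 - p (snd z) (fst z)) - 2 * q (snd z) (fst z)"] intp intq by simp
    also have "\<dots> = 2 * (\<integral>z. 1 - p (snd z) (fst z) \<partial>?N) - 2 * (\<integral>z. q (snd z) (fst z) \<partial>?N)"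
      using intp intq by (subst Bochner_Integration.integral_diff) auto
    finally show "\<bar>T * average_cost M t (basis_proj k) \<rho> T
        - 2 * (1 - expectation (\<lambda>\<omega>. population (\<rho> t\<^sub>0 \<omega>) k)) * (T - t)\<bar>
        \<le> \<epsilon> * (T - t) + (2 * (t\<^sub>0 - t) + C / (2 * \<eta> * (\<epsilon> / 2) ^ 3))"
      using P Q Q0 unfolding c_def by (simp add: abs_le_iff algebra_simps)
  qed
qed

end

theorem theorem1:
  fixes M :: "'w measure" and F :: "real \<Rightarrow> 'w measure" and W :: "real \<Rightarrow> 'w \<Rightarrow> real"
    and j \<eta> t \<Delta> :: real and U :: "real set"
    and H\<^sub>c \<rho>\<^sub>t :: "'n::{finite, linorder} cmat"
    and \<phi> :: "'n \<Rightarrow> 'n cvec" and ev :: "'n \<Rightarrow> real" and f :: 'n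
    and u :: "real \<Rightarrow> real" and \<rho> :: "real \<Rightarrow> 'w \<Rightarrow> 'n cmat"
  assumes "j > 0" and "real CARD('n) = 2 * j + 1"
    and "\<And>k. J\<^sub>z j *v \<phi> k = complex_of_real (ev k) *s \<phi> k"
    and "\<And>k l. braket (\<phi> k) (\<phi> l) = (if k = l then 1 else 0)"
    and "wiener_process M F W"
    and "0 < \<eta>" and "\<eta> \<le> 1"
    and "hermitian H\<^sub>c"
    and "t \<ge> 0" and "\<Delta> > 0"
    and "density_matrix \<rho>\<^sub>t"
    and "admissible_control U t \<Delta> u"
    and "sme_solution M F W \<eta> (\<lambda>s. J\<^sub>z j + switched_off t \<Delta> u s *\<^sub>R H\<^sub>c) (J\<^sub>z j) t \<rho>\<^sub>t \<rho>"
  shows "(average_cost M t (ketbra (\<phi> f) (\<phi> f)) \<rho>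
            \<longlongrightarrow> infinite_horizon_cost M t (ketbra (\<phi> f) (\<phi> f)) \<rho>) at_top
       \<and> infinite_horizon_cost M t (ketbra (\<phi> f) (\<phi> f)) \<rho>
            = terminal_cost M (t + \<Delta>) (ketbra (\<phi> f) (\<phi> f)) \<rho>"
proof -
  interpret wiener M F W
    by unfold_locales fact
  define d :: "'n \<Rightarrow> real" where "d k = j - real (card {..<k})" for k
  have J: "J\<^sub>z j = real_diag d"
    unfolding J\<^sub>z_real_diag d_def ..
  have gap: "1 \<le> \<bar>d i - d k\<bar>" if "i \<noteq> k" for i k
    using card_lessThan_gap[OF that] by (simp add: d_def abs_minus_commute)
  then have "inj d"
    by (intro injI) fastforce
  \<comment> \<open>The eigenbasis may be labelled in any order, so \<open>k\<close> can differ from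
    \<open>f\<close>.\<close>
  then obtain k where k: "ketbra (\<phi> f) (\<phi> f) = basis_proj k"
    using ketbra_eigenvector[of d "\<phi> f" "ev f"] assms(3,4) by (auto simp: J)
  \<comment> \<open>The instant t + \<Delta> still belongs to the control phase, which matches the
    freedom required only strictly afterwards.\<close>
  have "(average_cost M t (basis_proj k) \<rho>
      \<longlongrightarrow> 2 * (1 - expectation (\<lambda>\<omega>. population (\<rho> (t + \<Delta>) \<omega>) k))) at_top"
    using assms(13)[unfolded J] assms(6,9)
    by (rule average_cost_limit) (use assms(10) gap in \<open>auto simp: switched_off_def\<close>)
  \<comment> \<open>A population is linear in the state, so averaging over the noise may be done
    inside it.\<close>
  moreover have "expectation (\<lambda>\<omega>. population (\<rho> (t + \<Delta>) \<omega>) k) = population (mean_state M \<rho> (t + \<Delta>)) k"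
    unfolding mean_state_def
    using integral_bounded_linear[OF bounded_linear_population sme_integrable[OF assms(13)]] assms(10) by simp
  ultimately have lim: "(average_cost M t (basis_proj k) \<rho> \<longlongrightarrow> terminal_cost M (t + \<Delta>) (basis_proj k) \<rho>) at_top"
    by (simp add: terminal_cost_def trace_mult_basis_proj population_def)
  then have "infinite_horizon_cost M t (basis_proj k) \<rho> = terminal_cost M (t + \<Delta>) (basis_proj k) \<rho>"
    unfolding infinite_horizon_cost_def by (intro tendsto_Lim) simp
  with lim show ?thesis
    by (simp add: k)
qed

end
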